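(* Let $G$ be a graph and let $\widehat{G}$ be its suspension. Then the cut polytope $\mathrm{Cut}^\square(\widehat{G})$ is normal if and only if $G$ has no $K_4$ minor.
   Context: All graphs are finite, without loops or multiple edges. For a graph $G$ on the vertex set $[n]=\{1,\dots,n\}$ with edge set $E$ and for $S\subset[n]$, let $\delta_G(S)\in\mathbb{R}^E$ be the $0/1$ vector with $\delta_G(S)_{ij}=1$ if $|S\cap\{i,j\}|=1$ and $\delta_G(S)_{ij}=0$ otherwise, for $ij\in E$. Let $A_G=\{\delta_G(S)\mid S\subset[n]\}\subset\mathbb{Z}^E$. The cut polytope $\mathrm{Cut}^\square(G)$ is the convex hull of $A_G$. Let $X_G=\left\{\binom{\mathbf{a}}{1} \mid \mathbf{a}\in A_G\right\}\subset\mathbb{Z}^{E+1}$ (each vector of $A_G$ with an extra last coordinate $1$ appended), and let $\mathbb{Z}(X_G)$, $\mathbb{Q}_+(X_G)$, $\mathbb{Z}_+(X_G)$ denote the sets of all linear combinations of elements of $X_G$ with coefficients that are, respectively, integers, nonnegative rationals, nonnegative integers. The cut polytope $\mathrm{Cut}^\square(G)$ is called normal if $\mathbb{Z}_+(X_G)=\mathbb{Z}(X_G)\cap\mathbb{Q}_+(X_G)$. The suspension of a graph $G$ with vertex set $V=[n]$ and edge set $E$ is the graph $\widehat{G}$ with vertex set $[n+1]=V\cup\{n+1\}$ and edge set $E\cup\{\{i,n+1\}\mid i\in V\}$. $K_4$ is the complete graph on 4 vertices. *)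

theory Defs
  imports "HOL-Analysis.Analysis"
begin

type_synonym 'a graph = "'a set \<times> 'a set set"

abbreviation verts :: "'a graph \<Rightarrow> 'a set" where
  "verts G \<equiv> fst G"

abbreviation edges :: "'a graph \<Rightarrow> 'a set set" where
  "edges G \<equiv> snd G"

definition is_graph :: "'a graph \<Rightarrow> bool" where
  "is_graph G \<longleftrightarrow> finite (verts G) \<and> (\<forall>e\<in>edges G. e \<subseteq> verts G \<and> card e = 2)"

definition complete_graph :: "'a set \<Rightarrow> 'a graph" where
  "complete_graph V = (V, {e. e \<subseteq> V \<and> card e = 2})"

definition graph_iso :: "'a graph \<Rightarrow> 'b graph \<Rightarrow> bool" where
  "graph_iso G H \<longleftrightarrow>
     (\<exists>f. bij_betw f (verts G) (verts H) \<and> (\<lambda>e. f ` e) ` edges G = edges H)"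

text \<open>Contracting the edge \<open>{u, v}\<close> merges \<open>v\<close> into \<open>u\<close>; parallel edges are
  identified because edges form a set, and no loop arises because \<open>{u, v}\<close> itself is removed.\<close>

inductive minor_step :: "'a graph \<Rightarrow> 'a graph \<Rightarrow> bool" where
  delete_vertex: "v \<in> V \<Longrightarrow> minor_step (V, E) (V - {v}, {e \<in> E. v \<notin> e})"
| delete_edge: "e \<in> E \<Longrightarrow> minor_step (V, E) (V, E - {e})"
| contract_edge: "{u, v} \<in> E \<Longrightarrow> u \<noteq> v \<Longrightarrow>
    minor_step (V, E)
      (V - {v}, (\<lambda>e. (\<lambda>x. if x = v then u else x) ` e) ` (E - {{u, v}}))"

definition has_minor :: "'a graph \<Rightarrow> 'b graph \<Rightarrow> bool" where
  "has_minor G H \<longleftrightarrow> (\<exists>G'. minor_step\<^sup>*\<^sup>* G G' \<and> graph_iso G' H)"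

definition suspension :: "nat \<Rightarrow> nat set set \<Rightarrow> nat graph" where
  "suspension n E = ({1..n + 1}, E \<union> {{i, n + 1} | i. i \<in> {1..n}})"

text \<open>A vector of \<open>\<real>\<^sup>E\<close> is represented by a function on all sets of vertices that
  vanishes outside \<open>E\<close>. In \<open>\<real>\<^bsup>E+1\<^esup>\<close> the extra last coordinate has index \<open>None\<close>,
  the coordinate of the edge \<open>e\<close> has index \<open>Some e\<close>.\<close>

definition cut_vector :: "'a graph \<Rightarrow> 'a set \<Rightarrow> 'a set \<Rightarrow> real" where
  "cut_vector G S e = (if e \<in> edges G \<and> card (S \<inter> e) = 1 then 1 else 0)"

definition cut_vectors :: "'a graph \<Rightarrow> ('a set \<Rightarrow> real) set" where
  "cut_vectors G = {cut_vector G S | S. S \<subseteq> verts G}"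

definition homogenize :: "('i \<Rightarrow> real) \<Rightarrow> 'i option \<Rightarrow> real" where
  "homogenize a i = (case i of None \<Rightarrow> 1 | Some e \<Rightarrow> a e)"

definition hom_cut_vectors :: "'a graph \<Rightarrow> ('a set option \<Rightarrow> real) set" where
  "hom_cut_vectors G = homogenize ` cut_vectors G"

text \<open>All linear combinations of elements of \<open>X\<close> with coefficients in \<open>C\<close>, for finite \<open>X\<close>
  (the sum is the junk value \<open>0\<close> for infinite \<open>X\<close>).\<close>

definition lin_combs :: "real set \<Rightarrow> ('i \<Rightarrow> real) set \<Rightarrow> ('i \<Rightarrow> real) set" where
  "lin_combs C X = {(\<lambda>i. \<Sum>x\<in>X. c x * x i) | c. \<forall>x\<in>X. c x \<in> C}"

lemma finite_hom_cut_vectors: "is_graph G \<Longrightarrow> finite (hom_cut_vectors G)"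
  by (simp add: hom_cut_vectors_def cut_vectors_def is_graph_def)

text \<open>Normality of the cut polytope of \<open>G\<close>. It is a condition on the vectors whose convex
  hull is the polytope, so the convex hull itself does not occur.\<close>

definition cut_polytope_normal :: "'a graph \<Rightarrow> bool" where
  "cut_polytope_normal G \<longleftrightarrow>
     lin_combs \<nat> (hom_cut_vectors G) =
     lin_combs \<int> (hom_cut_vectors G) \<inter> lin_combs {q \<in> \<rat>. 0 \<le> q} (hom_cut_vectors G)"

end

theory Submission
  imports Defs
begin

text \<open>
  Cuts of the suspension correspond to subsets \<open>S\<close> of \<open>{1..n}\<close>, and a combination of cut vectors with
  coefficients \<open>c S\<close> carries the same information as the total weight \<open>t\<close>, the masses
  \<open>p i = (\<Sum>S | i \<in> S. c S)\<close> of the vertices and the masses \<open>p i j = (\<Sum>S | i \<in> S \<and> j \<in> S. c S)\<close> of the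
  edges of \<open>G\<close> (\<open>cut_comb_eq_iff\<close>). A combination with coefficients in \<open>\<nat>\<close> is a family of subsets
  \<open>A i\<close> of a \<open>t\<close>-element set with \<open>card (A i) = p i\<close>, and \<open>card (A i \<inter> A j) = p i j\<close> on the edges. So
  normality says that integral masses which are realised by nonnegative rational weights are
  realised by such a family of sets.

  If \<open>G\<close> has a $K_4$ minor, take \<open>t = 4\<close> and give every vertex of $K_4$ mass 2 and every edge mass 1.
  The weight \<open>1/4\<close> on each of the sixteen subsets realises this, but four 2-element subsets of a
  4-element set cannot pairwise meet in exactly one element (\<open>no_four_pairs_meeting_once\<close>). The
  masses pull back to \<open>G\<close> along the map that sends a vertex to its branch set, with mass 0 for vertices
  outside all branch sets. All vertices of a
  branch set are forced to have the same set, so the obstruction survives (\<open>K4_minor_obstructed\<close>).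
  Since any two vertices of $K_4$ are adjacent, edges of \<open>G\<close> that are lost in passing to the minor
  also have integral mass.

  If \<open>G\<close> has no $K_4$ minor, it is a subgraph of a 2-tree (\<open>K4_minor_free_partial_2tree\<close>), because a
  graph of minimum degree at least 3 has a $K_4$ minor (\<open>min_degree_3_has_K4_minor\<close>). On the 2-tree
  rational weights induce masses also for the edges that are missing in \<open>G\<close>, and these may be
  fractional. They can be rounded: for a single triangle, one pair mass can be rounded up or down at
  will and the two others can then be rounded so that the result is realised by sets
  (\<open>triangle_rounding\<close>). Triangles of a 2-tree are glued along edges, and the common pair mass is
  the only datum that has to agree (\<open>rounded_realisation\<close>).
\<close>

section \<open>Graphs without a $K_4$ minor\<close>

text \<open>The subgraphs of 2-trees, together with a construction sequence: each new vertex is attached to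
  an earlier edge. The inclusion for \<open>E\<close> allows edges of the 2-tree, old or new, to be missing; the
  case \<open>a = b\<close> covers a vertex that has at most one earlier neighbour.\<close>
inductive partial_2tree :: "'v set \<Rightarrow> 'v set set \<Rightarrow> bool" where
  empty: "partial_2tree {} {}"
| single: "partial_2tree {v} {}"
| add_vertex: "partial_2tree V E' \<Longrightarrow> v \<notin> V \<Longrightarrow> a \<in> V \<Longrightarrow> b \<in> V \<Longrightarrow> a = b \<or> {a, b} \<in> E' \<Longrightarrow>
    E \<subseteq> E' \<union> {{a, v}, {b, v}} \<Longrightarrow> partial_2tree (insert v V) E"

lemma partial_2tree_edge_subset: "partial_2tree V E \<Longrightarrow> e \<in> E \<Longrightarrow> e \<subseteq> V"
  by (induction arbitrary: e rule: partial_2tree.induct) blast+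

abbreviation K4 :: "nat graph" where "K4 \<equiv> complete_graph {1..4}"

definition neighbours :: "'a set set \<Rightarrow> 'a \<Rightarrow> 'a set" where
  "neighbours E v = {w. {v, w} \<in> E}"

definition contract :: "'a \<Rightarrow> 'a \<Rightarrow> 'a set set \<Rightarrow> 'a set set" where
  "contract u v E = (\<lambda>e. (\<lambda>x. if x = v then u else x) ` e) ` (E - {{u, v}})"

lemma has_minor_step: "minor_step G G' \<Longrightarrow> has_minor G' H \<Longrightarrow> has_minor G H"
  unfolding has_minor_def by (meson converse_rtranclp_into_rtranclp)

lemma contract_step: "{u, v} \<in> E \<Longrightarrow> u \<noteq> v \<Longrightarrow> minor_step (V, E) (V - {v}, contract u v E)"
  unfolding contract_def by (rule contract_edge)

lemma graph_edge_cases: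
  assumes "is_graph (V, E)" "e \<in> E"
  obtains x y where "e = {x, y}" "x \<noteq> y" "x \<in> V" "y \<in> V"
  using assms unfolding is_graph_def by (fastforce simp: card_2_iff)

lemma graph_edgeD:
  assumes "is_graph (V, E)" "{x, y} \<in> E"
  shows "x \<noteq> y" "x \<in> V" "y \<in> V"
  using assms unfolding is_graph_def by auto

lemma is_graph_delete_vertex: "is_graph (V, E) \<Longrightarrow> is_graph (V - {v}, {e \<in> E. v \<notin> e})"
  unfolding is_graph_def by auto

lemma mem_contract_iff:
  assumes G: "is_graph (V, E)" and uv: "u \<noteq> v"
  shows "e \<in> contract u v E \<longleftrightarrow>
    v \<notin> e \<and> (e \<in> E \<or> (\<exists>w. w \<noteq> u \<and> e = {u, w} \<and> {v, w} \<in> E))" (is "_ \<longleftrightarrow> ?R")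
proof
  assume "e \<in> contract u v E"
  then obtain e' where e': "e' \<in> E" "e' \<noteq> {u, v}" "e = (\<lambda>x. if x = v then u else x) ` e'"
    unfolding contract_def by auto
  from graph_edge_cases[OF G e'(1)] obtain x y where xy: "e' = {x, y}" "x \<noteq> y" by metis
  show ?R using e' xy uv by (cases "x = v"; cases "y = v") (auto simp: insert_commute)
next
  assume R: ?R
  then consider "v \<notin> e" "e \<in> E" | w where "w \<noteq> u" "e = {u, w}" "{v, w} \<in> E" "v \<notin> e" by auto
  then show "e \<in> contract u v E"
  proof cases
    case 1
    then have "(\<lambda>x. if x = v then u else x) ` e = e" by force
    then show ?thesis using 1 unfolding contract_def by (intro image_eqI[of _ _ e]) auto
  next
    case 2
    then have "(\<lambda>x. if x = v then u else x) ` {v, w} = e" by auto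
    moreover have "{v, w} \<noteq> {u, v}" using 2 by (auto simp: doubleton_eq_iff)
    ultimately show ?thesis using 2 unfolding contract_def by (intro image_eqI[of _ _ "{v, w}"]) auto
  qed
qed

lemma is_graph_contract:
  assumes "is_graph (V, E)" "{u, v} \<in> E"
  shows "is_graph (V - {v}, contract u v E)"
proof -
  note uv = graph_edgeD[OF assms]
  have "e \<subseteq> V - {v} \<and> card e = 2" if "e \<in> contract u v E" for e
    using that assms uv unfolding mem_contract_iff[OF assms(1) uv(1)]
    by (auto simp: is_graph_def dest: graph_edgeD[OF assms(1)])
  then show ?thesis using assms unfolding is_graph_def by auto
qed

text \<open>Delete the vertices outside \<open>W\<close> one at a time.\<close>
lemma induced_subgraph_steps:
  assumes "finite V" "W \<subseteq> V"
  shows "is_graph (V, E) \<Longrightarrow> minor_step\<^sup>*\<^sup>* (V, E) (W, {e \<in> E. e \<subseteq> W})"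
  using assms
proof (induction "card (V - W)" arbitrary: V E)
  case 0
  then have "V = W" by auto
  then have "{e \<in> E. e \<subseteq> W} = E" using 0 by (auto simp: is_graph_def)
  then show ?case using \<open>V = W\<close> by simp
next
  case (Suc n)
  then obtain v where v: "v \<in> V" "v \<notin> W" by (metis DiffD1 DiffD2 card_eq_0_iff equals0I nat.distinct(1))
  have "V - {v} - W = (V - W) - {v}" by auto
  then have "n = card (V - {v} - W)" using v by (simp add: card_Diff_singleton flip: Suc(2))
  from Suc(1)[OF this is_graph_delete_vertex[OF Suc(3)]] Suc v
  have "minor_step\<^sup>*\<^sup>* (V - {v}, {e \<in> E. v \<notin> e}) (W, {e \<in> {e \<in> E. v \<notin> e}. e \<subseteq> W})" by auto
  moreover have "{e \<in> {e \<in> E. v \<notin> e}. e \<subseteq> W} = {e \<in> E. e \<subseteq> W}" using v by auto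
  ultimately show ?case using delete_vertex[OF v(1), of E] by (simp add: converse_rtranclp_into_rtranclp)
qed

lemma K4_subgraph_has_minor:
  assumes G: "is_graph (V, E)" and "distinct [a, b, c, d]"
    and E: "{a, b} \<in> E" "{a, c} \<in> E" "{a, d} \<in> E" "{b, c} \<in> E" "{b, d} \<in> E" "{c, d} \<in> E"
  shows "has_minor (V, E) K4"
proof -
  let ?W = "{a, b, c, d}"
  have W: "?W \<subseteq> V" using E graph_edgeD[OF G] by auto
  have "{e \<in> E. e \<subseteq> ?W} = {e. e \<subseteq> ?W \<and> card e = 2}"
  proof -
    have "e \<in> E" if "e \<subseteq> ?W" "card e = 2" for e
    proof -
      from that(2) obtain x y where "e = {x, y}" "x \<noteq> y" by (auto simp: card_2_iff)
      then show ?thesis using that(1) E by (auto simp: insert_commute[of _ _ "{}"])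
    qed
    moreover have "card e = 2" if "e \<in> E" for e using that G by (auto simp: is_graph_def)
    ultimately show ?thesis by blast
  qed
  moreover have "minor_step\<^sup>*\<^sup>* (V, E) (?W, {e \<in> E. e \<subseteq> ?W})"
    using induced_subgraph_steps[OF _ W G] G by (simp add: is_graph_def)
  ultimately have steps: "minor_step\<^sup>*\<^sup>* (V, E) (complete_graph ?W)" by (simp add: complete_graph_def)
  have "card ?W = card {1..4::nat}" using assms(2) by simp
  then obtain f where f: "bij_betw f ?W {1..4::nat}" using finite_same_card_bij[of ?W "{1..4::nat}"] by auto
  have "(\<lambda>e. f ` e) ` {e. e \<subseteq> ?W \<and> card e = 2} = {e. e \<subseteq> {1..4} \<and> card e = 2}" (is "?L = ?R")
  proof
    show "?L \<subseteq> ?R"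
    proof
      fix e assume "e \<in> ?L"
      then obtain e' where e': "e' \<subseteq> ?W" "card e' = 2" "e = f ` e'" by blast
      then have "card e = 2" using f by (metis bij_betw_def card_image inj_on_subset)
      moreover have "e \<subseteq> {1..4}" using e' f by (metis bij_betw_def image_mono)
      ultimately show "e \<in> ?R" by blast
    qed
    show "?R \<subseteq> ?L"
    proof
      fix e assume e: "e \<in> ?R"
      then have "e \<subseteq> f ` ?W" using f by (simp add: bij_betw_def)
      then obtain e' where e': "e' \<subseteq> ?W" "e = f ` e'" by (meson subset_image_iff)
      then have "card e' = card e" using f by (metis bij_betw_def card_image inj_on_subset)
      then show "e \<in> ?L" using e e' by auto
    qed
  qed
  then have "graph_iso (complete_graph ?W) K4" using f unfolding graph_iso_def complete_graph_def fst_conv snd_conv by blast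
  then show ?thesis using steps unfolding has_minor_def by blast
qed

lemma neighbours_subset: "is_graph (V, E) \<Longrightarrow> neighbours E v \<subseteq> V - {v}"
  unfolding neighbours_def using graph_edgeD[of V E v] by blast

lemma finite_neighbours: "is_graph (V, E) \<Longrightarrow> finite (neighbours E v)"
  using neighbours_subset by (metis finite_Diff finite_subset fst_conv is_graph_def)

lemma neighbours_sym: "w \<in> neighbours E v \<longleftrightarrow> v \<in> neighbours E w"
  by (simp add: neighbours_def insert_commute)

lemma pair_mem_contract_iff:
  assumes "is_graph (V, E)" "u \<noteq> v"
  shows "{w, x} \<in> contract u v E \<longleftrightarrow> w \<noteq> v \<and> x \<noteq> v \<and>
    ({w, x} \<in> E \<or> (w = u \<and> x \<noteq> u \<and> {v, x} \<in> E) \<or> (x = u \<and> w \<noteq> u \<and> {v, w} \<in> E))"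
proof -
  have "(\<exists>y. y \<noteq> u \<and> {w, x} = {u, y} \<and> {v, y} \<in> E) \<longleftrightarrow>
    (w = u \<and> x \<noteq> u \<and> {v, x} \<in> E) \<or> (x = u \<and> w \<noteq> u \<and> {v, w} \<in> E)"
    unfolding doubleton_eq_iff by metis
  moreover have "v \<notin> {w, x} \<longleftrightarrow> w \<noteq> v \<and> x \<noteq> v" by auto
  ultimately show ?thesis unfolding mem_contract_iff[OF assms] by (simp only: conj_assoc)
qed

lemma neighbours_contract:
  assumes "is_graph (V, E)" "{u, v} \<in> E" "w \<noteq> v"
  shows "neighbours (contract u v E) w =
    (if w = u then neighbours E u \<union> neighbours E v - {u, v}
     else neighbours E w - {v} \<union> (if v \<in> neighbours E w then {u} else {}))"
proof -
  have uv: "u \<noteq> v" and l: "{u} \<notin> E" using graph_edgeD(1)[OF assms(1,2)] graph_edgeD(1)[OF assms(1), of u u] by auto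
  have "{v, w} = {w, v}" by blast
  then show ?thesis unfolding neighbours_def pair_mem_contract_iff[OF assms(1) uv] using assms(3) uv l by auto
qed

text \<open>Contracting one of the two edges at a vertex of degree 2 replaces the path through it by an edge,
  which may already be present.\<close>
lemma suppress_step:
  assumes G: "is_graph (V, E)" and N: "neighbours E v = {a, b}" and ab: "a \<noteq> b"
  shows "minor_step (V, E) (V - {v}, {e \<in> E. v \<notin> e} \<union> {{a, b}})"
proof -
  have vE: "{v, w} \<in> E \<longleftrightarrow> w = a \<or> w = b" for w using N unfolding neighbours_def by blast
  have va: "{a, v} \<in> E" using vE[of a] by (simp add: insert_commute)
  have ne: "a \<noteq> v" "b \<noteq> v" using vE graph_edgeD(1)[OF G] by blast+
  have "contract a v E = {e \<in> E. v \<notin> e} \<union> {{a, b}}"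
    unfolding set_eq_iff mem_contract_iff[OF G ne(1)] vE using ne ab by auto
  then show ?thesis using contract_step[OF va ne(1), of V] by simp
qed

lemma is_graph_suppress:
  assumes G: "is_graph (V, E)" and N: "neighbours E v = {a, b}" and ab: "a \<noteq> b"
  shows "is_graph (V - {v}, {e \<in> E. v \<notin> e} \<union> {{a, b}})"
  using is_graph_delete_vertex[OF G, of v] neighbours_subset[OF G, of v] ab unfolding N
  by (simp add: is_graph_def)

lemma neighbours_suppress:
  assumes "w \<noteq> v" "a \<noteq> b"
  shows "neighbours ({e \<in> E. v \<notin> e} \<union> {{a, b}}) w =
    neighbours E w - {v} \<union> (if w = a then {b} else if w = b then {a} else {})"
  using assms unfolding neighbours_def by (auto simp: doubleton_eq_iff)

text \<open>A vertex other than the merged one loses a neighbour only if it was adjacent to both ends of the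
  contracted edge.\<close>
lemma contract_keeps_degree_3:
  assumes G: "is_graph (V, E)" and deg: "\<And>w. w \<in> V \<Longrightarrow> 3 \<le> card (neighbours E w)" and xy: "{x, y} \<in> E"
    and common: "\<And>w. w \<in> neighbours E x \<inter> neighbours E y \<Longrightarrow> 4 \<le> card (neighbours E w)"
    and merged: "3 \<le> card (neighbours E x \<union> neighbours E y - {x, y})"
    and w: "w \<in> V - {y}"
  shows "3 \<le> card (neighbours (contract x y E) w)"
proof -
  note fin = finite_neighbours[OF G]
  consider "w = x" | "w \<noteq> x" "y \<notin> neighbours E w" | "w \<noteq> x" "y \<in> neighbours E w" "x \<in> neighbours E w"
    | "w \<noteq> x" "y \<in> neighbours E w" "x \<notin> neighbours E w" by blast
  then show ?thesis
  proof cases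
    case 1
    then show ?thesis using merged w by (simp add: neighbours_contract[OF G xy])
  next
    case 2
    then show ?thesis using deg[of w] w by (simp add: neighbours_contract[OF G xy])
  next
    case 3
    then have "4 \<le> card (neighbours E w)" using common[of w] neighbours_sym by (metis IntI)
    moreover have "neighbours (contract x y E) w = neighbours E w - {y}"
      using 3 w graph_edgeD[OF G xy] by (auto simp: neighbours_contract[OF G xy])
    ultimately show ?thesis using 3 fin by (simp add: card_Diff_singleton)
  next
    case 4
    then have "neighbours (contract x y E) w = insert x (neighbours E w - {y})"
      using w by (simp add: neighbours_contract[OF G xy])
    then show ?thesis using 4 fin deg[of w] w by (simp add: card_Diff_singleton)
  qed
qed

text \<open>Contracting \<open>xy\<close> and then suppressing the remaining vertex, which has degree 2, takes the two
  neighbours \<open>x\<close> and \<open>y\<close> away from \<open>b\<close> and from \<open>c\<close> but makes \<open>b\<close> and \<open>c\<close> adjacent. So both keep degree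
  at least \<open>4 - 2 + 1\<close>.\<close>
lemma diamond_keeps_degree_3:
  assumes G: "is_graph (V, E)" and deg: "\<And>w. w \<in> V \<Longrightarrow> 3 \<le> card (neighbours E w)"
    and N: "neighbours E x = {y, b, c}" "neighbours E y = {x, b, c}" and bc: "b \<noteq> c" "{b, c} \<notin> E"
    and deg4: "4 \<le> card (neighbours E b)" "4 \<le> card (neighbours E c)"
  obtains E' where "minor_step\<^sup>*\<^sup>* (V, E) (V - {y} - {x}, E')" "is_graph (V - {y} - {x}, E')"
    "\<And>w. w \<in> V - {y} - {x} \<Longrightarrow> 3 \<le> card (neighbours E' w)" "b \<in> V - {y} - {x}"
proof -
  have xy: "{x, y} \<in> E" using N(1) unfolding neighbours_def by blast
  have mem: "y \<in> V - {x}" "b \<in> V - {x}" "c \<in> V - {x}" "b \<in> V - {y}" "c \<in> V - {y}"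
    using neighbours_subset[OF G, of x] neighbours_subset[OF G, of y] N by auto
  define E1 where "E1 = contract x y E"
  have G1: "is_graph (V - {y}, E1)" using is_graph_contract[OF G xy] by (simp add: E1_def)
  have N1: "neighbours E1 x = {b, c}" using mem N by (auto simp: E1_def neighbours_contract[OF G xy])
  define E' where "E' = {e \<in> E1. x \<notin> e} \<union> {{b, c}}"
  have "minor_step (V, E) (V - {y}, E1)" using contract_step[OF xy, of V] mem by (auto simp: E1_def)
  moreover have "minor_step (V - {y}, E1) (V - {y} - {x}, E')"
    using suppress_step[OF G1 N1 bc(1)] by (simp add: E'_def)
  ultimately have "minor_step\<^sup>*\<^sup>* (V, E) (V - {y} - {x}, E')" by simp
  moreover have "is_graph (V - {y} - {x}, E')" using is_graph_suppress[OF G1 N1 bc(1)] by (simp add: E'_def)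
  moreover have "3 \<le> card (neighbours E' w)" if w: "w \<in> V - {y} - {x}" for w
  proof -
    have "neighbours E1 w - {x} = neighbours E w - {x, y}"
      using w by (auto simp: E1_def neighbours_contract[OF G xy])
    then have N': "neighbours E' w = neighbours E w - {x, y} \<union> (if w = b then {c} else if w = c then {b} else {})"
      unfolding E'_def by (subst neighbours_suppress) (use w bc in simp_all)
    have card: "card (neighbours E w) - 2 \<le> card (neighbours E w - {x, y})"
      using diff_card_le_card_Diff[of "{x, y}" "neighbours E w"] mem by auto
    have fin: "finite (neighbours E w - {x, y})" using finite_neighbours[OF G] by simp
    consider "w = b" | "w = c" | "w \<notin> {b, c}" by blast
    then show ?thesis
    proof cases
      case 1
      then have "c \<notin> neighbours E w" using bc by (simp add: neighbours_def)
      then show ?thesis using 1 N' card deg4 fin by simp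
    next
      case 2
      then have "b \<notin> neighbours E w" using bc by (simp add: neighbours_def insert_commute)
      then show ?thesis using 2 N' card deg4 fin bc by simp
    next
      case 3
      then have "x \<notin> neighbours E w" "y \<notin> neighbours E w"
        using w N neighbours_sym[of x E w] neighbours_sym[of y E w] by auto
      then show ?thesis using 3 N' deg[of w] w by auto
    qed
  qed
  ultimately show thesis using that mem by blast
qed

text \<open>Induction on the number of vertices. If some edge can be contracted without producing a vertex of
  degree below 3, contract it. Otherwise each edge either lies in a triangle whose third vertex has
  degree 3, or joins two vertices of degree 3 with the same two further neighbours. In both cases
  there is a diamond, that is, adjacent vertices \<open>x\<close> and \<open>y\<close> of degree 3 with the same two further
  neighbours \<open>b\<close> and \<open>c\<close>. If \<open>b\<close> and \<open>c\<close> are adjacent, this is a complete graph on four vertices.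
  If not, then \<open>b\<close> and \<open>c\<close> have degree at least 4, since the third edge at a vertex \<open>b\<close> of degree 3
  could be contracted, and the diamond can be replaced by the edge \<open>bc\<close>.\<close>
lemma min_degree_3_has_K4_minor:
  assumes "is_graph (V, E)" "V \<noteq> {}" "\<And>v. v \<in> V \<Longrightarrow> 3 \<le> card (neighbours E v)"
  shows "has_minor (V, E) K4"
  using assms
proof (induction "card V" arbitrary: V E rule: less_induct)
  case less
  note G = less.prems(1) and deg = less.prems(3)
  note fin = finite_neighbours[OF G]
  have finV: "finite V" using G by (simp add: is_graph_def)
  let ?N = "neighbours E"
  have N_iff: "w \<in> ?N v \<longleftrightarrow> {v, w} \<in> E" for v w by (simp add: neighbours_def)
  have irr: "v \<notin> ?N v" for v using neighbours_subset[OF G, of v] by auto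
  show ?case
  proof (cases "\<exists>x y. {x, y} \<in> E \<and> (\<forall>w\<in>?N x \<inter> ?N y. 4 \<le> card (?N w)) \<and> 3 \<le> card (?N x \<union> ?N y - {x, y})")
    case True
    then obtain x y where xy: "{x, y} \<in> E" "\<And>w. w \<in> ?N x \<inter> ?N y \<Longrightarrow> 4 \<le> card (?N w)"
      "3 \<le> card (?N x \<union> ?N y - {x, y})" by blast
    note D = graph_edgeD[OF G xy(1)]
    have "has_minor (V - {y}, contract x y E) K4"
    proof (rule less.hyps)
      show "card (V - {y}) < card V" using finV D by (intro psubset_card_mono) auto
      show "V - {y} \<noteq> {}" using D by blast
      show "is_graph (V - {y}, contract x y E)" by (rule is_graph_contract[OF G xy(1)])
      show "3 \<le> card (neighbours (contract x y E) w)" if "w \<in> V - {y}" for w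
        using contract_keeps_degree_3[OF G deg xy that] .
    qed
    then show ?thesis using has_minor_step[OF contract_step[OF xy(1) D(1)]] by blast
  next
    case False
    have bad: "(\<exists>w\<in>?N x \<inter> ?N y. card (?N w) = 3) \<or> card (?N x \<union> ?N y - {x, y}) < 3" if "{x, y} \<in> E" for x y
    proof (rule ccontr)
      assume neg: "\<not> ?thesis"
      have "4 \<le> card (?N w)" if w: "w \<in> ?N x \<inter> ?N y" for w
      proof -
        have "w \<in> V" using w neighbours_subset[OF G, of x] by blast
        then have "3 \<le> card (?N w)" by (rule deg)
        moreover have "card (?N w) \<noteq> 3" using neg w by blast
        ultimately show ?thesis by linarith
      qed
      moreover have "3 \<le> card (?N x \<union> ?N y - {x, y})" using neg by linarith
      ultimately show False using False \<open>{x, y} \<in> E\<close> by blast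
    qed
    \<comment> \<open>Each end has at least \<open>3 - 1\<close> neighbours besides the other end, and all of them become
      neighbours of the merged vertex. If the latter has degree 2, both ends have the same two.\<close>
    have merged2: "\<exists>b c. b \<noteq> c \<and> ?N x = {y, b, c} \<and> ?N y = {x, b, c}"
      if xy: "{x, y} \<in> E" and less3: "card (?N x \<union> ?N y - {x, y}) < 3" for x y
    proof -
      let ?U = "?N x \<union> ?N y - {x, y}"
      note D = graph_edgeD[OF G xy]
      have mem: "y \<in> ?N x" "x \<in> ?N y" using xy by (auto simp: N_iff insert_commute)
      have finU: "finite ?U" using fin by blast
      have c2: "2 \<le> card (?N x - {y})" "2 \<le> card (?N y - {x})"
        using deg[OF D(2)] deg[OF D(3)] mem fin by (simp_all add: card_Diff_singleton)
      have sub: "?N x - {y} \<subseteq> ?U" "?N y - {x} \<subseteq> ?U" using irr by auto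
      have eq: "?N x - {y} = ?U" using card_seteq[OF finU sub(1)] c2 less3 by linarith
      have eq': "?N y - {x} = ?U" using card_seteq[OF finU sub(2)] c2 less3 by linarith
      have "card ?U = 2" using c2(1) less3 unfolding eq by linarith
      then obtain b c where "?U = {b, c}" "b \<noteq> c" unfolding card_2_iff by blast
      moreover have "?N x = insert y (?N x - {y})" "?N y = insert x (?N y - {x})" using mem by blast+
      ultimately show ?thesis using eq eq' by metis
    qed
    have "\<exists>x y b c. b \<noteq> c \<and> ?N x = {y, b, c} \<and> ?N y = {x, b, c}"
    proof (cases "\<exists>x y. {x, y} \<in> E \<and> card (?N x \<union> ?N y - {x, y}) < 3")
      case True
      then show ?thesis using merged2 by metis
    next
      case False
      then have tri: "\<exists>w\<in>?N x \<inter> ?N y. card (?N w) = 3" if "y \<in> ?N x" for x y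
        using bad that by (simp add: N_iff)
      \<comment> \<open>Two triangles at a vertex \<open>v\<close> of degree 3, one on the edge \<open>va\<close> and one on the edge to the
        remaining neighbour \<open>c\<close>, force a diamond.\<close>
      obtain v0 where "v0 \<in> V" using less.prems(2) by blast
      then have "?N v0 \<noteq> {}" using deg[of v0] by auto
      then obtain v where v: "card (?N v) = 3" using tri by blast
      then obtain a where a: "a \<in> ?N v" by fastforce
      obtain b where b: "b \<in> ?N v" "b \<in> ?N a" "card (?N b) = 3" using tri[OF a] by blast
      have "a \<noteq> b" using b irr by blast
      have "card (?N v - {a, b}) = 1" using v a b(1) \<open>a \<noteq> b\<close> by (simp add: card_Diff_subset)
      then obtain c where c: "?N v - {a, b} = {c}" by (auto simp: card_1_singleton_iff)
      then have Nv: "?N v = {a, b, c}" and ne: "c \<noteq> a" "c \<noteq> b" using a b(1) by blast+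
      have nv: "a \<noteq> v" "b \<noteq> v" "c \<noteq> v" using Nv irr[of v] by auto
      obtain d where d: "d \<in> ?N v" "d \<in> ?N c" "card (?N d) = 3" using tri[of c v] Nv by blast
      have three: "?N d = {p, q, r}" if "p \<in> ?N d" "q \<in> ?N d" "r \<in> ?N d" "p \<noteq> q" "p \<noteq> r" "q \<noteq> r" for p q r
        using card_subset_eq[OF fin[of d], of "{p, q, r}"] d(3) that by auto
      have sym: "c \<in> ?N d" "v \<in> ?N d" using d neighbours_sym by metis+
      have "d \<noteq> c" using d(2) irr by blast
      then consider "d = b" | "d = a" using d(1) Nv by blast
      then show ?thesis
      proof cases
        case 1
        have "a \<in> ?N b" using b(2) neighbours_sym by metis
        then have "?N b = {v, a, c}" using three[of v a c] sym 1 nv ne by blast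
        moreover have "?N v = {b, a, c}" using Nv by blast
        ultimately show ?thesis using ne(1) by metis
      next
        case 2
        then have "?N a = {v, b, c}" using three[of v b c] sym b(2) nv ne by blast
        then show ?thesis using Nv ne(2) by metis
      qed
    qed
    then obtain x y b c where bc: "b \<noteq> c" and Nx: "?N x = {y, b, c}" and Ny: "?N y = {x, b, c}" by blast
    have E: "{x, y} \<in> E" "{x, b} \<in> E" "{x, c} \<in> E" "{y, b} \<in> E" "{y, c} \<in> E"
      using Nx Ny by (auto simp flip: N_iff)
    note D = graph_edgeD[OF G E(1)] graph_edgeD[OF G E(2)] graph_edgeD[OF G E(3)] graph_edgeD[OF G E(4)] graph_edgeD[OF G E(5)]
    show ?thesis
    proof (cases "{b, c} \<in> E")
      case True
      then show ?thesis using E D bc by (intro K4_subgraph_has_minor[OF G, of x y b c]) auto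
    next
      case False
      \<comment> \<open>A vertex \<open>p\<close> of degree 3 among \<open>b\<close> and \<open>c\<close> has exactly one neighbour \<open>z\<close> outside the diamond.
        The edge \<open>pz\<close> lies in no triangle and merges into a vertex of degree at least 4, so it would be
        contractible.\<close>
      have deg4: "4 \<le> card (?N p)" if p: "p \<in> {b, c}" for p
      proof (rule ccontr)
        assume "\<not> 4 \<le> card (?N p)"
        moreover have pV: "p \<in> V" using p D by blast
        ultimately have card_p: "card (?N p) = 3" using deg[of p] by linarith
        have xyp: "x \<in> ?N p" "y \<in> ?N p" "x \<noteq> y" using p E D by (auto simp: N_iff insert_commute)
        have "card (?N p - {x, y}) = 1" using xyp card_p by (simp add: card_Diff_subset)
        then obtain z where z: "?N p - {x, y} = {z}" by (auto simp: card_1_singleton_iff)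
        then have Np: "?N p = {x, y, z}" and zne: "z \<noteq> x" "z \<noteq> y" using xyp by blast+
        have pz: "{p, z} \<in> E" using Np by (simp flip: N_iff)
        have "z \<noteq> p" using graph_edgeD(1)[OF G pz] by simp
        have "z \<notin> {b, c}"
        proof
          assume "z \<in> {b, c}"
          then have "{p, z} = {b, c}" using p \<open>z \<noteq> p\<close> by blast
          then show False using pz False by simp
        qed
        then have "z \<notin> ?N x" "z \<notin> ?N y" using Nx Ny zne by simp_all
        then have zxy: "x \<notin> ?N z" "y \<notin> ?N z" using neighbours_sym by metis+
        have pNz: "p \<in> ?N z" using Np neighbours_sym by (metis insertCI)
        have "?N p \<inter> ?N z = {}" using Np zxy irr[of z] by auto
        then have less3: "card (?N p \<union> ?N z - {p, z}) < 3" using bad[OF pz] by blast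
        have "{x, y} \<union> (?N z - {p}) \<subseteq> ?N p \<union> ?N z - {p, z}" using xyp zne p D irr[of z] by auto
        then have "card ({x, y} \<union> (?N z - {p})) \<le> card (?N p \<union> ?N z - {p, z})"
          using fin by (intro card_mono) auto
        moreover have "card ({x, y} \<union> (?N z - {p})) = 2 + card (?N z - {p})"
          using zxy xyp(3) fin by (subst card_Un_disjoint) auto
        moreover have "2 \<le> card (?N z - {p})"
          using deg[of z] graph_edgeD[OF G pz] pNz fin by (simp add: card_Diff_singleton)
        ultimately show False using less3 by linarith
      qed
      obtain E' where E': "minor_step\<^sup>*\<^sup>* (V, E) (V - {y} - {x}, E')" "is_graph (V - {y} - {x}, E')"
        "\<And>w. w \<in> V - {y} - {x} \<Longrightarrow> 3 \<le> card (neighbours E' w)" "b \<in> V - {y} - {x}"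
        by (rule diamond_keeps_degree_3[OF G deg Nx Ny bc False]) (use deg4 in auto)
      have "card (V - {y} - {x}) < card V" using finV D by (intro psubset_card_mono) auto
      from less.hyps[OF this E'(2) _ E'(3)] E'(4) have "has_minor (V - {y} - {x}, E') K4" by blast
      then show ?thesis using E'(1) unfolding has_minor_def by (meson rtranclp_trans)
    qed
  qed
qed

text \<open>Remove a vertex of degree at most 2. If it has two neighbours, suppressing it instead of deleting
  it makes them adjacent, which is what attaching it again requires.\<close>
lemma K4_minor_free_partial_2tree:
  assumes "is_graph (V, E)" "\<not> has_minor (V, E) K4"
  shows "partial_2tree V E"
  using assms
proof (induction "card V" arbitrary: V E rule: less_induct)
  case less
  note G = less.prems(1)
  have finV: "finite V" using G by (simp add: is_graph_def)
  show ?case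
  proof (cases "\<exists>v. V \<subseteq> {v}")
    case True
    have "E = {}"
    proof (rule equals0I)
      fix e assume "e \<in> E"
      then obtain x y where "x \<noteq> y" "x \<in> V" "y \<in> V" by (rule graph_edge_cases[OF G])
      then show False using True by blast
    qed
    moreover from True consider "V = {}" | v where "V = {v}" by (meson subset_singletonD)
    ultimately show ?thesis using partial_2tree.intros(1,2) by metis
  next
    case False
    then have "V \<noteq> {}" by blast
    then obtain v where v: "v \<in> V" "card (neighbours E v) < 3"
      using min_degree_3_has_K4_minor[OF G] less.prems(2) by (meson not_less)
    have less_V: "card (V - {v}) < card V" using v finV by (intro psubset_card_mono) auto
    have Nsub: "neighbours E v \<subseteq> V - {v}" by (rule neighbours_subset[OF G])
    have edges: "E \<subseteq> {e \<in> E. v \<notin> e} \<union> {{a, v} |a. a \<in> neighbours E v}"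
    proof
      fix e assume e: "e \<in> E"
      show "e \<in> {e \<in> E. v \<notin> e} \<union> {{a, v} |a. a \<in> neighbours E v}"
      proof (cases "v \<in> e")
        case True
        obtain x y where "e = {x, y}" using e by (rule graph_edge_cases[OF G])
        then obtain a where "e = {a, v}" using True by blast
        moreover have "a \<in> neighbours E v" using e calculation by (simp add: neighbours_def insert_commute)
        ultimately show ?thesis by blast
      qed (use e in blast)
    qed
    have Vv: "insert v (V - {v}) = V" using v by blast
    show ?thesis
    proof (cases "card (neighbours E v) = 2")
      case True
      then obtain a b where N: "neighbours E v = {a, b}" "a \<noteq> b" by (auto simp: card_2_iff)
      have "\<not> has_minor (V - {v}, {e \<in> E. v \<notin> e} \<union> {{a, b}}) K4"
        using has_minor_step[OF suppress_step[OF G N]] less.prems(2) by blast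
      from less.hyps[OF less_V is_graph_suppress[OF G N] this]
      have "partial_2tree (insert v (V - {v})) E"
        by (rule partial_2tree.add_vertex[where a = a and b = b]) (use N Nsub edges in auto)
      then show ?thesis unfolding Vv .
    next
      case False
      then have le1: "card (neighbours E v) \<le> 1" using v(2) by linarith
      obtain w where "w \<in> V - {v}" using \<open>\<not> (\<exists>v. V \<subseteq> {v})\<close> by blast
      obtain a where a: "a \<in> V - {v}" "neighbours E v \<subseteq> {a}"
      proof (cases "neighbours E v = {}")
        case True
        then show ?thesis using that \<open>w \<in> V - {v}\<close> by blast
      next
        case False
        then obtain a where "neighbours E v = {a}" using le1 finite_neighbours[OF G, of v]
          by (metis card_0_eq card_1_singletonE le_antisym less_one not_le)
        then show ?thesis using that Nsub by blast
      qed
      have "\<not> has_minor (V - {v}, {e \<in> E. v \<notin> e}) K4"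
        using has_minor_step[OF delete_vertex[OF v(1)]] less.prems(2) by blast
      from less.hyps[OF less_V is_graph_delete_vertex[OF G] this]
      have "partial_2tree (insert v (V - {v})) E"
        by (rule partial_2tree.add_vertex[where a = a and b = a]) (use a edges in blast)+
      then show ?thesis unfolding Vv .
    qed
  qed
qed

section \<open>Rounding pair masses on partial 2-trees\<close>

text \<open>Here \<open>a\<close>, \<open>b\<close>, \<open>c\<close> are the masses of three events, \<open>x\<close>, \<open>y\<close>, \<open>z\<close> those of their pairwise
  intersections and \<open>q\<close> that of the triple intersection; the eight hypotheses say that the cells of
  the Venn diagram have nonnegative mass. For prescribed \<open>X\<close> the values \<open>Y\<close>, \<open>Z\<close>, \<open>Q\<close> are found by
  eliminating \<open>Q\<close>, then \<open>Z\<close>, then \<open>Y\<close>. Each variable occurs in its bounds with coefficient 1 or \<open>-1\<close>, so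
  its bounds are integers and its least admissible value is an integer. A lower bound stays below
  an upper bound for one of two reasons. Either the two combine to an inequality such as
  \<open>2 * X \<le> a + b\<close>, which follows from \<open>X \<le> a\<close> and \<open>X \<le> b\<close>; or they combine to an integer
  inequality that the real solution satisfies with an error below 1.\<close>
lemma triangle_rounding:
  fixes t a b c X :: int and x y z q :: real
  assumes cells: "0 \<le> q" "q \<le> x" "q \<le> y" "q \<le> z" "x + y - q \<le> a" "x + z - q \<le> b" "y + z - q \<le> c"
    "a + b + c - x - y - z + q \<le> t"
    and X: "\<bar>X - x\<bar> < 1"
  shows "\<exists>Y Z Q::int. \<bar>Y - y\<bar> < 1 \<and> \<bar>Z - z\<bar> < 1 \<and> 0 \<le> Q \<and> Q \<le> X \<and> Q \<le> Y \<and> Q \<le> Z \<and>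
    X + Y - Q \<le> a \<and> X + Z - Q \<le> b \<and> Y + Z - Q \<le> c \<and> a + b + c - X - Y - Z + Q \<le> t"
proof -
  define l l' m m' where "l = \<lfloor>y\<rfloor>" and "l' = \<lceil>y\<rceil>" and "m = \<lfloor>z\<rfloor>" and "m' = \<lceil>z\<rceil>"
  have l: "l \<le> y" "y < l + 1" "y \<le> l'" "l' - 1 < y" and m: "m \<le> z" "z < m + 1" "z \<le> m'" "m' - 1 < z"
    unfolding l_def l'_def m_def m'_def by linarith+
  have ll: "l \<le> l'" "m \<le> m'" using l m by linarith+
  have X': "X < x + 1" "x < X + 1" using X by linarith+
  have bX: "0 \<le> X" "X \<le> a" "X \<le> b" "a + b - X \<le> t" using X' cells by linarith+
  have bl: "0 \<le> l" "l \<le> a" "l \<le> c" "a + c - l \<le> t" "0 \<le> l'" "l' \<le> a" "l' \<le> c" "a + c - l' \<le> t"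
    using l cells by linarith+
  have bm: "0 \<le> m" "m \<le> b" "m \<le> c" "b + c - m \<le> t" "0 \<le> m'" "m' \<le> b" "m' \<le> c" "b + c - m' \<le> t"
    using m cells by linarith+
  \<comment> \<open>\<open>Y\<close> must leave room for some \<open>Z\<close> between \<open>m\<close> and \<open>m'\<close>.\<close>
  define Y where "Y = max l (max (a + b + c - t - X - m') (m + X - b))"
  have Yge: "l \<le> Y" "a + b + c - t - X - m' \<le> Y" "m + X - b \<le> Y" unfolding Y_def by simp_all
  have "a + b + c - t - X - m' \<le> l'" "m + X - b \<le> l'" "l \<le> m' + a - X" "l \<le> c + X - m"
    using cells l m X' by linarith+
  then have Yle: "Y \<le> l'" "Y \<le> m' + a - X" "Y \<le> c + X - m"
    using bX bm ll unfolding Y_def max.bounded_iff by (intro conjI; linarith)+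
  have bY: "0 \<le> Y" "Y \<le> a" "Y \<le> c" "a + c - Y \<le> t" using Yge Yle bl by linarith+
  define Z where "Z = max m (max (Y + X - a) (a + b + c - t - X - Y))"
  have Zge: "m \<le> Z" "Y + X - a \<le> Z" "a + b + c - t - X - Y \<le> Z" unfolding Z_def by simp_all
  have Zle: "Z \<le> m'" "Z \<le> Y + b - X" "Z \<le> c + X - Y"
    using bX bY ll Yge Yle unfolding Z_def max.bounded_iff by (intro conjI; linarith)+
  have bZ: "0 \<le> Z" "Z \<le> b" "Z \<le> c" "b + c - Z \<le> t" using Zge Zle bm by linarith+
  define Q where "Q = max (max 0 (X + Y - a)) (max (X + Z - b) (Y + Z - c))"
  have Qge: "0 \<le> Q" "X + Y - a \<le> Q" "X + Z - b \<le> Q" "Y + Z - c \<le> Q" unfolding Q_def by simp_all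
  have Qle: "Q \<le> X" "Q \<le> Y" "Q \<le> Z" "Q \<le> t - (a + b + c - X - Y - Z)"
    using bX bY bZ Yge Yle Zge Zle unfolding Q_def max.bounded_iff by (intro conjI; linarith)+
  have "real_of_int l \<le> Y" "real_of_int Y \<le> l'" "real_of_int m \<le> Z" "real_of_int Z \<le> m'" using Yge Yle Zge Zle by simp_all
  then have "\<bar>Y - y\<bar> < 1" "\<bar>Z - z\<bar> < 1" using l m by linarith+
  then show ?thesis using Qge Qle by (intro exI[of _ Y] exI[of _ Z] exI[of _ Q] conjI; linarith)
qed

text \<open>\<open>C\<close> takes \<open>Q\<close>, \<open>Y - Q\<close>, \<open>Z - Q\<close> and \<open>c - Y - Z + Q\<close> elements from the cells \<open>A \<inter> B\<close>, \<open>A - B\<close>, \<open>B - A\<close> and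
  \<open>T - (A \<union> B)\<close>, which the hypotheses make large enough.\<close>
lemma exists_set_with_intersections:
  fixes c Y Z Q :: int
  assumes "finite T" "A \<subseteq> T" "B \<subseteq> T"
    and "0 \<le> Q" "Q \<le> int (card (A \<inter> B))" "Q \<le> Y" "Q \<le> Z"
    and "card (A \<inter> B) + Y - Q \<le> card A" "card (A \<inter> B) + Z - Q \<le> card B" "Y + Z - Q \<le> c"
    and "card A + card B + c - card (A \<inter> B) - Y - Z + Q \<le> card T"
  shows "\<exists>C\<subseteq>T. int (card C) = c \<and> int (card (A \<inter> C)) = Y \<and> int (card (B \<inter> C)) = Z"
proof -
  have fin: "finite A" "finite B" using assms finite_subset by blast+
  have cA: "int (card (A - B)) = int (card A) - card (A \<inter> B)" and cB: "int (card (B - A)) = int (card B) - card (A \<inter> B)"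
    using fin by (simp_all add: card_Diff_subset_Int Int_commute card_mono of_nat_diff)
  have "card (A \<union> B) + card (A \<inter> B) = card A + card B" using fin card_Un_Int by fastforce
  moreover have "int (card (T - (A \<union> B))) = int (card T) - card (A \<union> B)"
    using assms(1-3) fin by (simp add: card_Diff_subset card_mono of_nat_diff)
  ultimately have cT: "int (card (T - (A \<union> B))) = int (card T) - card A - card B + card (A \<inter> B)" by linarith
  have "nat Q \<le> card (A \<inter> B)" using assms by linarith
  from obtain_subset_with_card_n[OF this] obtain C1 where C1: "C1 \<subseteq> A \<inter> B" "card C1 = nat Q" "finite C1" by blast
  have "nat (Y - Q) \<le> card (A - B)" using assms cA by linarith
  from obtain_subset_with_card_n[OF this] obtain C2 where C2: "C2 \<subseteq> A - B" "card C2 = nat (Y - Q)" "finite C2" by blast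
  have "nat (Z - Q) \<le> card (B - A)" using assms cB by linarith
  from obtain_subset_with_card_n[OF this] obtain C3 where C3: "C3 \<subseteq> B - A" "card C3 = nat (Z - Q)" "finite C3" by blast
  have "nat (c - Y - Z + Q) \<le> card (T - (A \<union> B))" using assms cT by linarith
  from obtain_subset_with_card_n[OF this] obtain C4 where C4: "C4 \<subseteq> T - (A \<union> B)" "card C4 = nat (c - Y - Z + Q)" "finite C4" by blast
  define C where "C = (C1 \<union> C2) \<union> (C3 \<union> C4)"
  have i: "A \<inter> C = C1 \<union> C2" "B \<inter> C = C1 \<union> C3" using C1 C2 C3 C4 by (auto simp: C_def)
  have 12: "card (C1 \<union> C2) = card C1 + card C2" by (rule card_Un_disjoint) (use C1 C2 in auto)
  have 13: "card (C1 \<union> C3) = card C1 + card C3" by (rule card_Un_disjoint) (use C1 C3 in auto)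
  have 34: "card (C3 \<union> C4) = card C3 + card C4" by (rule card_Un_disjoint) (use C3 C4 in auto)
  have "card C = card (C1 \<union> C2) + card (C3 \<union> C4)" unfolding C_def by (rule card_Un_disjoint) (use C1 C2 C3 C4 in auto)
  then have "int (card C) = c" "int (card (A \<inter> C)) = Y" "int (card (B \<inter> C)) = Z"
    unfolding i 12 13 34 C1 C2 C3 C4 using assms by simp_all
  moreover have "C \<subseteq> T" using C1 C2 C3 C4 assms by (auto simp: C_def)
  ultimately show ?thesis by blast
qed

definition pair_mass :: "'v set set \<Rightarrow> ('v set \<Rightarrow> real) \<Rightarrow> 'v \<Rightarrow> 'v \<Rightarrow> real" where
  "pair_mass P w u v = (\<Sum>S\<in>P. w S * of_bool (u \<in> S \<and> v \<in> S))"

lemma pair_mass_commute: "pair_mass P w u v = pair_mass P w v u"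
  by (simp add: pair_mass_def conj_commute)

text \<open>With the mass \<open>q\<close> of the triple intersection this supplies the hypotheses of
  \<open>triangle_rounding\<close>.\<close>
lemma triple_mass:
  assumes w: "\<And>S. S \<in> P \<Longrightarrow> 0 \<le> w S"
  defines "p \<equiv> pair_mass P w"
  obtains q where "0 \<le> q" "q \<le> p a b" "q \<le> p a c" "q \<le> p b c" "p a b + p a c - q \<le> p a a"
    "p a b + p b c - q \<le> p b b" "p a c + p b c - q \<le> p c c"
    "p a a + p b b + p c c - p a b - p a c - p b c + q \<le> sum w P"
proof
  define q where "q = (\<Sum>S\<in>P. w S * of_bool (a \<in> S \<and> b \<in> S \<and> c \<in> S))"
  note defs = q_def p_def pair_mass_def
  show "0 \<le> q" unfolding defs by (rule sum_nonneg) (simp add: w)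
  show "q \<le> p a b" unfolding defs by (rule sum_mono) (simp add: w of_bool_def)
  show "q \<le> p a c" unfolding defs by (rule sum_mono) (simp add: w of_bool_def)
  show "q \<le> p b c" unfolding defs by (rule sum_mono) (simp add: w of_bool_def)
  show "p a b + p a c - q \<le> p a a" unfolding defs sum.distrib[symmetric] sum_subtractf[symmetric]
    by (rule sum_mono) (simp add: w of_bool_def)
  show "p a b + p b c - q \<le> p b b" unfolding defs sum.distrib[symmetric] sum_subtractf[symmetric]
    by (rule sum_mono) (simp add: w of_bool_def)
  show "p a c + p b c - q \<le> p c c" unfolding defs sum.distrib[symmetric] sum_subtractf[symmetric]
    by (rule sum_mono) (simp add: w of_bool_def)
  show "p a a + p b b + p c c - p a b - p a c - p b c + q \<le> sum w P"
    unfolding defs sum.distrib[symmetric] sum_subtractf[symmetric]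
    by (rule sum_mono) (simp add: w of_bool_def)
qed

lemma rounding_of_Ints: "x \<in> \<int> \<Longrightarrow> \<bar>real_of_int m - x\<bar> < 1 \<Longrightarrow> real_of_int m = x"
  by (auto elim!: Ints_cases)

text \<open>The weights describe a fractional family of events with integer masses on the vertices. They are
  replaced by honest subsets of a \<open>t\<close>-element set, at the price of rounding the pair masses. The
  freedom to prescribe the rounding at one pair makes the induction along the construction of the
  partial 2-tree work: the old part and the triangle of the new vertex share only the pair \<open>a, b\<close>, so
  one of them is rounded first and the value that it gives to this pair is prescribed for the
  other. Which one comes first depends on where the prescribed pair lies.\<close>
theorem rounded_realisation:
  fixes w :: "'v set \<Rightarrow> real" and p :: "'v \<Rightarrow> 'v \<Rightarrow> real" and t :: nat and m :: int
  assumes w: "\<And>S. S \<in> P \<Longrightarrow> 0 \<le> w S" "sum w P = t"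
  defines "p \<equiv> pair_mass P w"
  assumes "partial_2tree V E" and "\<And>v. v \<in> V \<Longrightarrow> p v v \<in> \<int>"
    and "i \<in> V" "j \<in> V" "i = j \<or> {i, j} \<in> E" "\<bar>m - p i j\<bar> < 1"
  shows "\<exists>A. (\<forall>v\<in>V. A v \<subseteq> {..<t} \<and> card (A v) = p v v) \<and>
    (\<forall>u v. {u, v} \<in> E \<longrightarrow> \<bar>card (A u \<inter> A v) - p u v\<bar> < 1) \<and> int (card (A i \<inter> A j)) = m"
  using assms(4-)
proof (induction arbitrary: i j m rule: partial_2tree.induct)
  case empty
  then show ?case by simp
next
  case (single v)
  have "0 \<le> p v v" "p v v \<le> t"
    using w unfolding p_def pair_mass_def by (auto intro!: sum_nonneg sum_mono simp flip: w(2))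
  moreover have "m = p v v" using single by (intro rounding_of_Ints) auto
  ultimately have "0 \<le> m" "m \<le> t" by linarith+
  then show ?case using single \<open>m = p v v\<close> by (intro exI[of _ "\<lambda>_. {..<nat m}"]) auto
next
  case (add_vertex V E' v a b E)
  note pc = pair_mass_commute[of P w, folded p_def]
  have Vv: "u \<noteq> v" if "u \<in> V" for u using that add_vertex.hyps by blast
  obtain na nb nv where n: "p a a = of_int na" "p b b = of_int nb" "p v v = of_int nv"
    using add_vertex.prems(1) add_vertex.hyps by (meson Ints_cases insertCI)
  obtain q where q: "0 \<le> q" "q \<le> p a b" "q \<le> p a v" "q \<le> p b v" "p a b + p a v - q \<le> na"
    "p a b + p b v - q \<le> nb" "p a v + p b v - q \<le> nv"
    "of_int (na + nb + nv) - p a b - p a v - p b v + q \<le> of_int (int t)"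
  proof (rule triple_mass[of P w a b v, folded p_def])
    fix q assume "0 \<le> q" "q \<le> p a b" "q \<le> p a v" "q \<le> p b v" "p a b + p a v - q \<le> p a a"
      "p a b + p b v - q \<le> p b b" "p a v + p b v - q \<le> p v v"
      "p a a + p b b + p v v - p a b - p a v - p b v + q \<le> sum w P"
    then show thesis using n w(2) by (intro that[of q]) simp_all
  qed (use w in blast)
  \<comment> \<open>A realisation \<open>A'\<close> of the old part extends to the new vertex if the values on its triangle
      are consistent, because the sizes of all cells of a Venn diagram of three sets are then known.\<close>
  have glue: "\<exists>A. (\<forall>v\<in>insert v V. A v \<subseteq> {..<t} \<and> card (A v) = p v v) \<and>
    (\<forall>u v. {u, v} \<in> E \<longrightarrow> \<bar>card (A u \<inter> A v) - p u v\<bar> < 1) \<and> (\<forall>u\<in>V. A u = A' u) \<and> int (card (A a \<inter> A v)) = Y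
     \<and> int (card (A b \<inter> A v)) = Z"
    if A': "\<forall>v\<in>V. A' v \<subseteq> {..<t} \<and> card (A' v) = p v v"
      "\<forall>u v. {u, v} \<in> E' \<longrightarrow> \<bar>card (A' u \<inter> A' v) - p u v\<bar> < 1"
      and X: "int (card (A' a \<inter> A' b)) = X"
      and YZ: "\<bar>Y - p a v\<bar> < 1" "\<bar>Z - p b v\<bar> < 1" "0 \<le> Q" "Q \<le> X" "Q \<le> Y" "Q \<le> Z"
        "X + Y - Q \<le> na" "X + Z - Q \<le> nb" "Y + Z - Q \<le> nv" "na + nb + nv - X - Y - Z + Q \<le> int t"
    for A' :: "'v \<Rightarrow> nat set" and X Y Z Q :: int
  proof -
    have "int (card (A' a)) = na" "int (card (A' b)) = nb" using A'(1) add_vertex.hyps n by fastforce+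
    then obtain C where C: "C \<subseteq> {..<t}" "int (card C) = nv" "int (card (A' a \<inter> C)) = Y" "int (card (A' b \<inter> C)) = Z"
      using exists_set_with_intersections[of "{..<t}" "A' a" "A' b" Q Y Z nv] X YZ A'(1) add_vertex.hyps by auto
    define A where "A = A'(v := C)"
    have AV: "\<And>u. u \<in> V \<Longrightarrow> A u = A' u" "A v = C" using Vv by (auto simp: A_def)
    have "\<bar>card (A u1 \<inter> A u2) - p u1 u2\<bar> < 1" if e: "{u1, u2} \<in> E" for u1 u2
    proof -
      consider "{u1, u2} \<in> E'" | "{u1, u2} = {a, v}" | "{u1, u2} = {b, v}" using e add_vertex.hyps by blast
      then show ?thesis
      proof cases
        case 1
        then have "u1 \<in> V" "u2 \<in> V" using partial_2tree_edge_subset[OF add_vertex.hyps(1)] by blast+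
        then show ?thesis using 1 A'(2) AV by simp
      next
        case 2
        have "\<bar>card (A a \<inter> A v) - p a v\<bar> < 1" using AV add_vertex.hyps C YZ(1) by (simp flip: C(3))
        then show ?thesis using 2 pc by (auto simp: doubleton_eq_iff Int_commute)
      next
        case 3
        have "\<bar>card (A b \<inter> A v) - p b v\<bar> < 1" using AV add_vertex.hyps C YZ(2) by (simp flip: C(4))
        then show ?thesis using 3 pc by (auto simp: doubleton_eq_iff Int_commute)
      qed
    qed
    then show ?thesis using AV C A'(1) n add_vertex.hyps by (intro exI[of _ A]) (simp flip: C(2))
  qed
  have int: "\<And>u. u \<in> V \<Longrightarrow> p u u \<in> \<int>" using add_vertex.prems by blast
  have ijE': "{i, j} \<in> E'" if "i \<in> V" "j \<in> V" "i \<noteq> j"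
    using that add_vertex Vv by (auto simp: doubleton_eq_iff)
  \<comment> \<open>If the prescribed pair is old, the old part is rounded first.\<close>
  have old: "\<exists>A. (\<forall>v\<in>insert v V. A v \<subseteq> {..<t} \<and> card (A v) = p v v) \<and>
    (\<forall>u v. {u, v} \<in> E \<longrightarrow> \<bar>card (A u \<inter> A v) - p u v\<bar> < 1) \<and> int (card (A i \<inter> A j)) = m"
    if ij: "i \<in> V" "j \<in> V" "i = j \<or> {i, j} \<in> E'" "\<bar>m - p i j\<bar> < 1" for i j m
  proof -
    obtain A' where A': "\<forall>v\<in>V. A' v \<subseteq> {..<t} \<and> card (A' v) = p v v"
      "\<forall>u v. {u, v} \<in> E' \<longrightarrow> \<bar>card (A' u \<inter> A' v) - p u v\<bar> < 1" "int (card (A' i \<inter> A' j)) = m"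
      using add_vertex.IH[OF int ij] by blast
    have "\<bar>int (card (A' a \<inter> A' b)) - p a b\<bar> < 1"
      using add_vertex.hyps A' by (cases "a = b") auto
    from triangle_rounding[OF q this]
    obtain Y Z Q where "\<bar>Y - p a v\<bar> < 1" "\<bar>Z - p b v\<bar> < 1" "0 \<le> Q" "Q \<le> int (card (A' a \<inter> A' b))" "Q \<le> Y" "Q \<le> Z"
        "int (card (A' a \<inter> A' b)) + Y - Q \<le> na" "int (card (A' a \<inter> A' b)) + Z - Q \<le> nb" "Y + Z - Q \<le> nv"
        "na + nb + nv - int (card (A' a \<inter> A' b)) - Y - Z + Q \<le> int t" by blast
    from glue[OF A'(1,2) refl this] show ?thesis using ij A'(3) by metis
  qed
  consider "i \<in> V" "j \<in> V" | "i = v" "j = v" | "{i, j} = {a, v}" | "{i, j} = {b, v}"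
    using add_vertex.prems(2-4) add_vertex.hyps partial_2tree_edge_subset[OF add_vertex.hyps(1)] by blast
  then show ?case
  proof cases
    case 1
    then have "i = j \<or> {i, j} \<in> E'" using ijE' by metis
    then show ?thesis using old 1 add_vertex.prems(5) by simp
  next
    case 2
    \<comment> \<open>The mass of \<open>v\<close> is forced, so the prescribed pair may be moved to the old vertex \<open>a\<close>.\<close>
    have "m = p v v" using 2 add_vertex.prems by (intro rounding_of_Ints) auto
    moreover obtain A where "\<forall>v\<in>insert v V. A v \<subseteq> {..<t} \<and> card (A v) = p v v"
      "\<forall>u v. {u, v} \<in> E \<longrightarrow> \<bar>card (A u \<inter> A v) - p u v\<bar> < 1"
      using old[of a a na] add_vertex.hyps n by auto
    ultimately show ?thesis using 2 by (intro exI[of _ A]) (simp flip: of_int_eq_iff[where 'a = real])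
  next
    case 3
    \<comment> \<open>If the prescribed pair contains the new vertex, its triangle is rounded first.\<close>
    have m: "\<bar>m - p a v\<bar> < 1" using 3 add_vertex.prems(5) pc by (auto simp: doubleton_eq_iff)
    have q': "p a v + p a b - q \<le> na" "p a v + p b v - q \<le> nv" "p a b + p b v - q \<le> nb"
      "of_int (na + nv + nb) - p a v - p a b - p b v + q \<le> of_int (int t)" using q by auto
    from triangle_rounding[OF q(1,3,2,4) q' m]
    obtain X Z Q where X: "\<bar>X - p a b\<bar> < 1" and XZ: "\<bar>Z - p b v\<bar> < 1" "0 \<le> Q" "Q \<le> X" "Q \<le> m" "Q \<le> Z"
        "X + m - Q \<le> na" "X + Z - Q \<le> nb" "m + Z - Q \<le> nv"
        "na + nb + nv - X - m - Z + Q \<le> int t" by (smt (verit))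
    obtain A' where A': "\<forall>v\<in>V. A' v \<subseteq> {..<t} \<and> card (A' v) = p v v"
      "\<forall>u v. {u, v} \<in> E' \<longrightarrow> \<bar>card (A' u \<inter> A' v) - p u v\<bar> < 1" "int (card (A' a \<inter> A' b)) = X"
      using add_vertex.IH[OF int add_vertex.hyps(3-5) X] by blast
    obtain A where "\<forall>v\<in>insert v V. A v \<subseteq> {..<t} \<and> card (A v) = p v v"
      "\<forall>u v. {u, v} \<in> E \<longrightarrow> \<bar>card (A u \<inter> A v) - p u v\<bar> < 1" "int (card (A a \<inter> A v)) = m"
      using glue[OF A' m XZ] by blast
    then show ?thesis using 3 by (intro exI[of _ A]) (auto simp: doubleton_eq_iff Int_commute)
  next
    case 4
    have m: "\<bar>m - p b v\<bar> < 1" using 4 add_vertex.prems(5) pc by (auto simp: doubleton_eq_iff)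
    have q': "p b v + p a b - q \<le> nb" "p b v + p a v - q \<le> nv" "p a b + p a v - q \<le> na"
      "of_int (nb + nv + na) - p b v - p a b - p a v + q \<le> of_int (int t)" using q by auto
    from triangle_rounding[OF q(1,4,2,3) q' m]
    obtain X Y Q where X: "\<bar>X - p a b\<bar> < 1" and Y: "\<bar>Y - p a v\<bar> < 1" and XY: "0 \<le> Q" "Q \<le> X" "Q \<le> Y" "Q \<le> m"
        "X + Y - Q \<le> na" "X + m - Q \<le> nb" "Y + m - Q \<le> nv"
        "na + nb + nv - X - Y - m + Q \<le> int t" by (smt (verit))
    obtain A' where A': "\<forall>v\<in>V. A' v \<subseteq> {..<t} \<and> card (A' v) = p v v"
      "\<forall>u v. {u, v} \<in> E' \<longrightarrow> \<bar>card (A' u \<inter> A' v) - p u v\<bar> < 1" "int (card (A' a \<inter> A' b)) = X"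
      using add_vertex.IH[OF int add_vertex.hyps(3-5) X] by blast
    obtain A where "\<forall>v\<in>insert v V. A v \<subseteq> {..<t} \<and> card (A v) = p v v"
      "\<forall>u v. {u, v} \<in> E \<longrightarrow> \<bar>card (A u \<inter> A v) - p u v\<bar> < 1" "int (card (A b \<inter> A v)) = m"
      using glue[OF A' Y m XY] by blast
    then show ?thesis using 4 by (intro exI[of _ A]) (auto simp: doubleton_eq_iff Int_commute)
  qed
qed

text \<open>An integral pair mass is its own only rounding. So only the masses of the pairs that the 2-tree
  has in addition to \<open>E\<close> are changed, and these may have been fractional.\<close>
corollary integral_realisation:
  fixes w :: "'v set \<Rightarrow> real" and t :: nat
  assumes w: "\<And>S. S \<in> P \<Longrightarrow> 0 \<le> w S" "sum w P = t" and T: "partial_2tree V E"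
    and int: "\<And>v. v \<in> V \<Longrightarrow> pair_mass P w v v \<in> \<int>" "\<And>u v. {u, v} \<in> E \<Longrightarrow> pair_mass P w u v \<in> \<int>"
  shows "\<exists>A. (\<forall>v\<in>V. A v \<subseteq> {..<t} \<and> card (A v) = pair_mass P w v v) \<and>
    (\<forall>u v. {u, v} \<in> E \<longrightarrow> card (A u \<inter> A v) = pair_mass P w u v)"
proof (cases "V = {}")
  case True
  then show ?thesis using partial_2tree_edge_subset[OF T] by blast
next
  case False
  then obtain v where v: "v \<in> V" by blast
  obtain m where "pair_mass P w v v = of_int m" using int(1)[OF v] by (rule Ints_cases)
  then obtain A where A: "\<forall>v\<in>V. A v \<subseteq> {..<t} \<and> card (A v) = pair_mass P w v v"
    "\<forall>u v. {u, v} \<in> E \<longrightarrow> \<bar>card (A u \<inter> A v) - pair_mass P w u v\<bar> < 1"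
    using rounded_realisation[OF w T int(1) v v, of m] by auto
  have "card (A u \<inter> A v) = pair_mass P w u v" if "{u, v} \<in> E" for u v
    using rounding_of_Ints[OF int(2)[OF that], of "int (card (A u \<inter> A v))"] A(2) that by simp
  then show ?thesis using A(1) by blast
qed

section \<open>Cut vectors of a suspension and pair masses\<close>

lemma sum_over_fibres:
  fixes w :: "'k \<Rightarrow> real"
  assumes "finite K" "finite P" "g ` K \<subseteq> P"
  shows "(\<Sum>S\<in>P. (\<Sum>k | k \<in> K \<and> g k = S. w k) * f S) = (\<Sum>k\<in>K. w k * f (g k))"
proof -
  have "(\<Sum>S\<in>P. (\<Sum>k | k \<in> K \<and> g k = S. w k) * f S) = (\<Sum>S\<in>P. \<Sum>k | k \<in> K \<and> g k = S. w k * f (g k))"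
    by (simp add: sum_distrib_right)
  then show ?thesis using sum.group[OF assms, of "\<lambda>k. w k * f (g k)"] by simp
qed

text \<open>List each member of \<open>P\<close> as often as its coefficient says.\<close>
lemma nat_coefficients_as_sequence:
  fixes c :: "'s \<Rightarrow> real"
  assumes P: "finite P" and c: "\<And>S. S \<in> P \<Longrightarrow> c S \<in> \<nat>"
  obtains t g where "g ` {..<t} \<subseteq> P" "sum c P = real t" "\<And>f :: 's \<Rightarrow> real. (\<Sum>S\<in>P. c S * f S) = (\<Sum>k<t. f (g k))"
proof -
  have "\<exists>d. \<forall>S\<in>P. c S = real (d S)" using c by (intro bchoice) (auto elim: Nats_cases)
  then obtain d where d: "\<And>S. S \<in> P \<Longrightarrow> c S = real (d S)" by blast
  define K where "K = Sigma P (\<lambda>S. {..<d S})"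
  have K: "finite K" "card K = sum d P" using P by (simp_all add: K_def)
  obtain h where h: "bij_betw h {..<card K} K" using ex_bij_betw_nat_finite[OF K(1)] by (auto simp: atLeast0LessThan)
  show thesis
  proof (rule that[of "fst \<circ> h" "card K"])
    have "fst x \<in> P" if "x \<in> K" for x using that by (auto simp: K_def)
    then show "(fst \<circ> h) ` {..<card K} \<subseteq> P" using bij_betwE[OF h] by (simp add: image_subset_iff)
    show "sum c P = real (card K)" unfolding K(2) using d by simp
    fix f :: "'s \<Rightarrow> real"
    have "(\<Sum>k<card K. f ((fst \<circ> h) k)) = (\<Sum>x\<in>K. f (fst x))"
      using sum.reindex_bij_betw[OF h, of "\<lambda>x. f (fst x)"] by simp
    also have "\<dots> = (\<Sum>(S, k)\<in>K. f S)" by (simp add: split_def)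
    also have "\<dots> = (\<Sum>S\<in>P. \<Sum>k<d S. f S)"
      unfolding K_def by (rule sum.Sigma[symmetric]) (use P in auto)
    also have "\<dots> = (\<Sum>S\<in>P. c S * f S)" using d by simp
    finally show "(\<Sum>S\<in>P. c S * f S) = (\<Sum>k<card K. f ((fst \<circ> h) k))" by simp
  qed
qed

lemma lin_combs_image:
  assumes "inj_on h P"
  shows "lin_combs C (h ` P) = {(\<lambda>i. \<Sum>S\<in>P. c S * h S i) | c. \<forall>S\<in>P. c S \<in> C}"
proof -
  have eq: "(\<lambda>i. \<Sum>x\<in>h ` P. c x * x i) = (\<lambda>i. \<Sum>S\<in>P. c (h S) * h S i)" for c
    by (rule ext) (simp only: sum.reindex[OF assms] o_def)
  show ?thesis
  proof (intro equalityI subsetI)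
    fix z assume "z \<in> lin_combs C (h ` P)"
    then obtain c where "z = (\<lambda>i. \<Sum>x\<in>h ` P. c x * x i)" "\<forall>x\<in>h ` P. c x \<in> C"
      unfolding lin_combs_def by (elim CollectE exE conjE)
    then show "z \<in> {(\<lambda>i. \<Sum>S\<in>P. c S * h S i) | c. \<forall>S\<in>P. c S \<in> C}" unfolding eq by (intro CollectI exI conjI) (assumption, simp)
  next
    fix z assume "z \<in> {(\<lambda>i. \<Sum>S\<in>P. c S * h S i) | c. \<forall>S\<in>P. c S \<in> C}"
    then obtain c where c: "z = (\<lambda>i. \<Sum>S\<in>P. c S * h S i)" "\<forall>S\<in>P. c S \<in> C"
      by (elim CollectE exE conjE)
    define d where "d = c \<circ> inv_into P h"
    have d: "d (h S) = c S" if "S \<in> P" for S using assms that unfolding d_def o_def by (simp only: inv_into_f_f)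
    have "z = (\<lambda>i. \<Sum>x\<in>h ` P. d x * x i)" unfolding eq c(1) by (rule ext, rule sum.cong[OF refl]) (simp only: d)
    moreover have "\<forall>x\<in>h ` P. d x \<in> C" using c(2) d by auto
    ultimately show "z \<in> lin_combs C (h ` P)" unfolding lin_combs_def by blast
  qed
qed

lemma of_bool_card_inter_pair:
  "i \<noteq> j \<Longrightarrow> of_bool (card (S \<inter> {i, j}) = 1) = (of_bool (i \<in> S) + of_bool (j \<in> S) - 2 * of_bool (i \<in> S \<and> j \<in> S) :: real)"
  by (cases "i \<in> S"; cases "j \<in> S") (simp_all add: Int_insert_right)

text \<open>Linear combinations of the homogenized cut vectors, indexed by the vertex sets that avoid the
  apex.\<close>
definition cut_comb :: "nat \<Rightarrow> nat set set \<Rightarrow> (nat set \<Rightarrow> real) \<Rightarrow> nat set option \<Rightarrow> real" where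
  "cut_comb n E c i = (\<Sum>S\<in>Pow {1..n}. c S * homogenize (cut_vector (suspension n E) S) i)"

context
  fixes n :: nat and E :: "nat set set"
  assumes G: "is_graph ({1..n}, E)"
begin

lemma suspension_edges: "edges (suspension n E) = E \<union> {{i, n + 1} | i. i \<in> {1..n}}"
  by (simp add: suspension_def)

lemma card_suspension_edge: "e \<in> edges (suspension n E) \<Longrightarrow> e \<subseteq> {1..n + 1} \<and> card e = 2"
proof -
  assume "e \<in> edges (suspension n E)"
  then consider "e \<in> E" | i where "i \<in> {1..n}" "e = {i, n + 1}" unfolding suspension_edges by blast
  then show "e \<subseteq> {1..n + 1} \<and> card e = 2"
  proof cases
    case 1
    then have "e \<subseteq> {1..n}" "card e = 2" using G by (simp_all add: is_graph_def)
    then show ?thesis by auto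
  qed auto
qed

lemma cut_vector_apex:
  assumes "i \<in> {1..n}" "S \<subseteq> {1..n}"
  shows "cut_vector (suspension n E) S {i, n + 1} = of_bool (i \<in> S)"
proof -
  have "n + 1 \<notin> S" using assms(2) by auto
  moreover have "{i, n + 1} \<in> edges (suspension n E)" using assms(1) unfolding suspension_edges by blast
  moreover have "i \<noteq> n + 1" using assms(1) by auto
  ultimately show ?thesis using of_bool_card_inter_pair[of i "n + 1" S] unfolding cut_vector_def by (simp add: of_bool_def)
qed

lemma cut_vector_edge:
  assumes "{i, j} \<in> E"
  shows "cut_vector (suspension n E) S {i, j} = of_bool (i \<in> S) + of_bool (j \<in> S) - 2 * of_bool (i \<in> S \<and> j \<in> S)"
  using assms of_bool_card_inter_pair[OF graph_edgeD(1)[OF G assms], of S]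
  unfolding cut_vector_def suspension_edges by (simp add: of_bool_def)

text \<open>Both sides of a cut define the same vector, so one may choose the side without the apex.\<close>
lemma cut_vector_complement:
  assumes "S \<subseteq> {1..n + 1}"
  shows "cut_vector (suspension n E) ({1..n + 1} - S) = cut_vector (suspension n E) S"
proof
  fix e
  show "cut_vector (suspension n E) ({1..n + 1} - S) e = cut_vector (suspension n E) S e"
  proof (cases "e \<in> edges (suspension n E)")
    case True
    then have e: "e \<subseteq> {1..n + 1}" "card e = 2" using card_suspension_edge by blast+
    then have fin: "finite e" by (simp add: finite_subset)
    have "({1..n + 1} - S) \<inter> e = e - S \<inter> e" using e by blast
    then have "card (({1..n + 1} - S) \<inter> e) = 2 - card (S \<inter> e)"
      using fin e by (simp add: card_Diff_subset)
    moreover have "card (S \<inter> e) \<le> 2" using card_mono[OF fin, of "S \<inter> e"] e by simp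
    ultimately have "card (({1..n + 1} - S) \<inter> e) = 1 \<longleftrightarrow> card (S \<inter> e) = 1" by linarith
    then show ?thesis unfolding cut_vector_def by simp
  qed (simp add: cut_vector_def)
qed

lemma hom_cut_vectors_suspension:
  "hom_cut_vectors (suspension n E) = (\<lambda>S. homogenize (cut_vector (suspension n E) S)) ` Pow {1..n}"
proof -
  have "cut_vectors (suspension n E) = cut_vector (suspension n E) ` Pow {1..n}"
  proof (intro equalityI subsetI)
    fix x assume "x \<in> cut_vectors (suspension n E)"
    then obtain S where S: "S \<subseteq> {1..n + 1}" "x = cut_vector (suspension n E) S"
      by (auto simp: cut_vectors_def suspension_def)
    show "x \<in> cut_vector (suspension n E) ` Pow {1..n}"
    proof (cases "n + 1 \<in> S")
      case True
      then have "{1..n + 1} - S \<subseteq> {1..n}" by (auto simp: le_Suc_eq)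
      then show ?thesis using S cut_vector_complement[OF S(1)] by (metis PowI imageI)
    next
      case False
      then have "S \<subseteq> {1..n}" using S(1) by (auto simp: le_Suc_eq)
      then show ?thesis using S(2) by blast
    qed
  next
    fix x assume "x \<in> cut_vector (suspension n E) ` Pow {1..n}"
    then obtain S where "S \<subseteq> {1..n}" "x = cut_vector (suspension n E) S" by blast
    moreover have "{1..n} \<subseteq> verts (suspension n E)" by (auto simp: suspension_def)
    ultimately show "x \<in> cut_vectors (suspension n E)" unfolding cut_vectors_def by blast
  qed
  then show ?thesis unfolding hom_cut_vectors_def by (simp add: image_image)
qed

lemma inj_on_hom_cut_vector: "inj_on (\<lambda>S. homogenize (cut_vector (suspension n E) S)) (Pow {1..n})"
proof (rule inj_onI)
  fix S T assume ST: "S \<in> Pow {1..n}" "T \<in> Pow {1..n}"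
    and eq: "homogenize (cut_vector (suspension n E) S) = homogenize (cut_vector (suspension n E) T)"
  have "i \<in> S \<longleftrightarrow> i \<in> T" if i: "i \<in> {1..n}" for i
  proof -
    have "homogenize (cut_vector (suspension n E) S) (Some {i, n + 1}) = homogenize (cut_vector (suspension n E) T) (Some {i, n + 1})"
      using eq by simp
    then have "of_bool (i \<in> S) = (of_bool (i \<in> T) :: real)"
      using cut_vector_apex[OF i] ST unfolding homogenize_def by simp
    then show ?thesis by (simp only: of_bool_eq_iff)
  qed
  then have "S \<inter> {1..n} = T \<inter> {1..n}" by blast
  then show "S = T" using ST by (simp add: Int_absorb2)
qed

lemma lin_combs_suspension:
  "lin_combs C (hom_cut_vectors (suspension n E)) = {cut_comb n E c | c. \<forall>S\<in>Pow {1..n}. c S \<in> C}"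
  unfolding hom_cut_vectors_suspension lin_combs_image[OF inj_on_hom_cut_vector] cut_comb_def[abs_def] ..

lemma cut_comb_None: "cut_comb n E c None = sum c (Pow {1..n})"
  by (simp add: cut_comb_def homogenize_def)

lemma cut_comb_apex: "i \<in> {1..n} \<Longrightarrow> cut_comb n E c (Some {i, n + 1}) = pair_mass (Pow {1..n}) c i i"
  unfolding cut_comb_def homogenize_def pair_mass_def option.case
  by (rule sum.cong[OF refl]) (simp only: cut_vector_apex Pow_iff conj_absorb)

lemma cut_comb_edge:
  assumes "{i, j} \<in> E"
  shows "cut_comb n E c (Some {i, j}) = pair_mass (Pow {1..n}) c i i + pair_mass (Pow {1..n}) c j j
    - 2 * pair_mass (Pow {1..n}) c i j"
  unfolding cut_comb_def homogenize_def pair_mass_def option.case cut_vector_edge[OF assms]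
  by (simp only: right_diff_distrib distrib_left sum.distrib sum_subtractf sum_distrib_left
      mult.left_commute[of _ 2] conj_absorb)

lemma cut_comb_no_edge: "e \<notin> edges (suspension n E) \<Longrightarrow> cut_comb n E c (Some e) = 0"
  by (simp add: cut_comb_def homogenize_def cut_vector_def)

text \<open>This is the covariance map: it turns cut vectors of the suspension into correlation vectors of
  the graph. The edge from \<open>i\<close> to the apex carries the mass of \<open>i\<close>, and on an edge \<open>ij\<close> the cut value is
  the mass of \<open>i\<close> plus the mass of \<open>j\<close> minus twice the mass of the pair.\<close>
lemma cut_comb_eq_iff:
  "cut_comb n E c = cut_comb n E d \<longleftrightarrow>
    sum c (Pow {1..n}) = sum d (Pow {1..n}) \<and>
    (\<forall>i\<in>{1..n}. pair_mass (Pow {1..n}) c i i = pair_mass (Pow {1..n}) d i i) \<and>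
    (\<forall>i j. {i, j} \<in> E \<longrightarrow> pair_mass (Pow {1..n}) c i j = pair_mass (Pow {1..n}) d i j)" (is "?L \<longleftrightarrow> ?R")
proof
  assume ?L
  then have eq: "cut_comb n E c k = cut_comb n E d k" for k by simp
  have d: "pair_mass (Pow {1..n}) c i i = pair_mass (Pow {1..n}) d i i" if "i \<in> {1..n}" for i
    using eq[of "Some {i, n + 1}"] cut_comb_apex[OF that] by simp
  moreover have "pair_mass (Pow {1..n}) c i j = pair_mass (Pow {1..n}) d i j" if e: "{i, j} \<in> E" for i j
    using eq[of "Some {i, j}"] d[of i] d[of j] graph_edgeD[OF G e] unfolding cut_comb_edge[OF e] by simp
  ultimately show ?R using eq[of None] unfolding cut_comb_None by blast
next
  assume R: ?R
  show ?L
  proof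
    fix k
    consider "k = None" | i where "i \<in> {1..n}" "k = Some {i, n + 1}" | i j where "{i, j} \<in> E" "k = Some {i, j}"
      | e where "e \<notin> edges (suspension n E)" "k = Some e"
    proof (cases k)
      case None
      then show ?thesis using that by blast
    next
      case (Some e)
      show ?thesis
      proof (cases "e \<in> E")
        case True
        then obtain i j where "e = {i, j}" by (rule graph_edge_cases[OF G])
        then show ?thesis using that(3) True Some by blast
      next
        case False
        then show ?thesis using that Some unfolding suspension_edges by blast
      qed
    qed
    then show "cut_comb n E c k = cut_comb n E d k"
    proof cases
      case 1
      then show ?thesis using R by (simp add: cut_comb_None)
    next
      case 2
      then show ?thesis using R unfolding 2(2) cut_comb_apex[OF 2(1)] by blast
    next
      case 3
      then show ?thesis using R graph_edgeD[OF G 3(1)] unfolding 3(2) cut_comb_edge[OF 3(1)] by simp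
    next
      case 4
      then show ?thesis by (simp add: cut_comb_no_edge)
    qed
  qed
qed

end

section \<open>The obstruction carried by a $K_4$ minor\<close>

text \<open>The sizes that four 2-element sets and their pairwise intersections have if any two of the sets
  meet in one element. The labels outside \<open>{1..4}\<close> stand for the empty set and serve for vertices that
  are deleted on the way to the minor.\<close>
definition K4_mass :: "nat \<Rightarrow> nat \<Rightarrow> nat" where
  "K4_mass i j = (if i \<in> {1..4} \<and> j \<in> {1..4} then if i = j then 2 else 1 else 0)"

text \<open>The labelling \<open>\<phi>\<close> is to be read as the map that sends each vertex to the vertex of $K_4$ into
  which it is contracted. The masses on $K_4$ are pulled back along it, and the graph is obstructed if
  they are not realised by subsets of a 4-element set.\<close>
definition obstructed :: "'a graph \<Rightarrow> ('a \<Rightarrow> nat) \<Rightarrow> bool" where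
  "obstructed G \<phi> \<longleftrightarrow> \<not> (\<exists>A :: 'a \<Rightarrow> nat set.
     (\<forall>v\<in>verts G. A v \<subseteq> {..<4} \<and> card (A v) = K4_mass (\<phi> v) (\<phi> v)) \<and>
     (\<forall>u v. {u, v} \<in> edges G \<longrightarrow> card (A u \<inter> A v) = K4_mass (\<phi> u) (\<phi> v)))"

text \<open>Each of \<open>B\<close>, \<open>C\<close>, \<open>D\<close> has one element in \<open>A\<close> and one in the complement of \<open>A\<close>, both of which have
  two elements. Two of these sets meet once exactly if they agree in one of the two choices, and three
  sets cannot pairwise do so: the number of disagreeing pairs is even for each choice, but it would
  have to be 3 in total.\<close>
lemma no_four_pairs_meeting_once:
  assumes sub: "\<And>X. X \<in> {A, B, C, D} \<Longrightarrow> X \<subseteq> {..<4::nat} \<and> card X = 2"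
    and meet: "card (A \<inter> B) = 1" "card (A \<inter> C) = 1" "card (A \<inter> D) = 1" "card (B \<inter> C) = 1" "card (B \<inter> D) = 1" "card (C \<inter> D) = 1"
  shows False
proof -
  obtain x y where A: "A = {x, y}" "x \<noteq> y" using sub[of A] by (auto simp: card_2_iff)
  have "card ({..<4} - A) = 2"
    using sub[of A] finite_subset[of A "{..<4}"] by (simp add: card_Diff_subset)
  then obtain z w where Ac: "{..<4} - A = {z, w}" "z \<noteq> w" by (auto simp: card_2_iff)
  then have ne: "x \<noteq> z" "x \<noteq> w" "y \<noteq> z" "y \<noteq> w" using A by blast+
  have cases: "X \<in> {{x, z}, {x, w}, {y, z}, {y, w}}" if X: "X \<subseteq> {..<4} \<and> card X = 2" "card (A \<inter> X) = 1" for X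
  proof -
    have "finite X" using X(1) finite_subset by auto
    then have "card (X - A) = 1" using X by (simp add: card_Diff_subset_Int Int_commute)
    then obtain c where c: "X - A = {c}" by (auto simp: card_1_singleton_iff)
    obtain b where b: "A \<inter> X = {b}" using X(2) by (auto simp: card_1_singleton_iff)
    have "X = {b, c}" using b c by blast
    moreover have "b \<in> {x, y}" using b A by blast
    moreover have "c \<in> {z, w}" using c X(1) Ac by blast
    ultimately show ?thesis by blast
  qed
  have "B \<in> {{x, z}, {x, w}, {y, z}, {y, w}}" "C \<in> {{x, z}, {x, w}, {y, z}, {y, w}}" "D \<in> {{x, z}, {x, w}, {y, z}, {y, w}}"
    by (rule cases; use sub meet(1-3) in simp)+
  then show False using meet(4-6) A(2) Ac(2) ne by (elim insertE emptyE) simp_all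
qed

lemma obstructed_K4:
  assumes "is_graph G" "graph_iso G K4"
  shows "\<exists>\<phi>. obstructed G \<phi>"
proof -
  obtain f where f: "bij_betw f (verts G) {1..4::nat}" and E: "(\<lambda>e. f ` e) ` edges G = {e. e \<subseteq> {1..4} \<and> card e = 2}"
    using assms unfolding graph_iso_def complete_graph_def by auto
  define g where "g = inv_into (verts G) f"
  have g: "g i \<in> verts G" "f (g i) = i" if "i \<in> {1..4}" for i
    using f that by (simp_all add: g_def bij_betw_def f_inv_into_f inv_into_into)
  have edge: "{g i, g j} \<in> edges G" if "i \<in> {1..4}" "j \<in> {1..4}" "i \<noteq> j" for i j
  proof -
    have "{i, j} \<in> (\<lambda>e. f ` e) ` edges G" unfolding E using that by simp
    then obtain e where e: "e \<in> edges G" "f ` e = {i, j}" by force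
    have "g ` f ` e = e" using assms(1) e(1) f unfolding g_def
      by (intro inv_into_image_cancel) (auto simp: is_graph_def bij_betw_def)
    then show ?thesis using e by simp
  qed
  have "obstructed G f" unfolding obstructed_def
  proof (rule notI, elim exE conjE)
    fix A :: "'a \<Rightarrow> nat set"
    assume A: "\<forall>v\<in>verts G. A v \<subseteq> {..<4} \<and> card (A v) = K4_mass (f v) (f v)"
      "\<forall>u v. {u, v} \<in> edges G \<longrightarrow> card (A u \<inter> A v) = K4_mass (f u) (f v)"
    have 2: "A (g i) \<subseteq> {..<4} \<and> card (A (g i)) = 2" if "i \<in> {1..4}" for i
      using A(1) g that by (simp add: K4_mass_def)
    have 1: "card (A (g i) \<inter> A (g j)) = 1" if "i \<in> {1..4}" "j \<in> {1..4}" "i \<noteq> j" for i j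
      using A(2)[rule_format, OF edge[OF that]] g that by (simp add: K4_mass_def)
    show False
    proof (rule no_four_pairs_meeting_once[of "A (g 1)" "A (g 2)" "A (g 3)" "A (g 4)"])
      show "X \<subseteq> {..<4} \<and> card X = 2" if "X \<in> {A (g 1), A (g 2), A (g 3), A (g 4)}" for X
        using that 2[of 1] 2[of 2] 2[of 3] 2[of 4] by (elim insertE emptyE) simp_all
    qed (use 1 in simp_all)
  qed
  then show ?thesis by blast
qed

lemma minor_step_is_graph:
  assumes "minor_step G G'" "is_graph G"
  shows "is_graph G'"
  using assms(1)
proof cases
  case (delete_vertex v V E)
  then show ?thesis using assms(2) is_graph_delete_vertex by simp
next
  case (delete_edge e E V)
  then show ?thesis using assms(2) by (simp add: is_graph_def)
next
  case (contract_edge u v E V)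
  then show ?thesis using assms(2) is_graph_contract[of V E u v] by (simp add: contract_def)
qed

text \<open>A realisation of the larger graph restricts to one of the smaller graph. For a contraction this
  holds because the two ends of the contracted edge have the same label, so their sets have the same
  size as their intersection and are equal.\<close>
lemma minor_step_obstructed:
  assumes "minor_step G G'" "is_graph G" "obstructed G' \<phi>'"
  shows "\<exists>\<phi>. obstructed G \<phi>"
  using assms(1)
proof cases
  case (delete_vertex v V E)
  have "obstructed G (\<phi>'(v := 0))" unfolding obstructed_def
  proof (rule notI, elim exE conjE)
    fix A :: "'a \<Rightarrow> nat set"
    assume A: "\<forall>w\<in>verts G. A w \<subseteq> {..<4} \<and> card (A w) = K4_mass ((\<phi>'(v := 0)) w) ((\<phi>'(v := 0)) w)"
      "\<forall>u w. {u, w} \<in> edges G \<longrightarrow> card (A u \<inter> A w) = K4_mass ((\<phi>'(v := 0)) u) ((\<phi>'(v := 0)) w)"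
    have "card (A u \<inter> A w) = K4_mass (\<phi>' u) (\<phi>' w)" if "{u, w} \<in> edges G'" for u w
      using that A(2)[rule_format, of u w] delete_vertex by auto
    moreover have "\<forall>w\<in>verts G'. A w \<subseteq> {..<4} \<and> card (A w) = K4_mass (\<phi>' w) (\<phi>' w)"
      using A(1) delete_vertex by auto
    ultimately show False using assms(3) unfolding obstructed_def by blast
  qed
  then show ?thesis by blast
next
  case (delete_edge e E V)
  then have "obstructed G \<phi>'"
    using assms(3) unfolding obstructed_def
    by (elim contrapos_nn) (metis Diff_iff fst_conv snd_conv)
  then show ?thesis by blast
next
  case (contract_edge u v E V)
  have G: "is_graph (V, E)" and G': "G' = (V - {v}, contract u v E)"
    using assms(2) contract_edge by (simp_all add: contract_def)
  note uv = graph_edgeD[OF G contract_edge(3)]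
  define \<phi> where "\<phi> = \<phi>'(v := \<phi>' u)"
  have "obstructed G \<phi>" unfolding obstructed_def
  proof (rule notI, elim exE conjE)
    fix A :: "'a \<Rightarrow> nat set"
    assume A: "\<forall>w\<in>verts G. A w \<subseteq> {..<4} \<and> card (A w) = K4_mass (\<phi> w) (\<phi> w)"
      "\<forall>x w. {x, w} \<in> edges G \<longrightarrow> card (A x \<inter> A w) = K4_mass (\<phi> x) (\<phi> w)"
    have "A u \<subseteq> {..<4}" "A v \<subseteq> {..<4}" using A(1) uv contract_edge by simp_all
    then have fin: "finite (A u)" "finite (A v)" using finite_subset finite_lessThan by blast+
    have "card (A u) = card (A u \<inter> A v)" "card (A v) = card (A u \<inter> A v)"
      using A uv contract_edge by (simp_all add: \<phi>_def)
    then have "A u \<inter> A v = A u" "A u \<inter> A v = A v" using fin by (metis card_subset_eq inf_le1 inf_le2)+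
    then have AA: "A v = A u" by simp
    have "card (A x \<inter> A w) = K4_mass (\<phi>' x) (\<phi>' w)" if xw: "{x, w} \<in> edges G'" for x w
    proof -
      have "x \<noteq> v" "w \<noteq> v" and c: "{x, w} \<in> E \<or> (x = u \<and> {v, w} \<in> E) \<or> (w = u \<and> {v, x} \<in> E)"
        using xw unfolding G' snd_conv pair_mem_contract_iff[OF G uv(1)] by auto
      from c consider "{x, w} \<in> E" | "x = u" "{v, w} \<in> E" | "w = u" "{x, v} \<in> E" by (auto simp: insert_commute)
      then show ?thesis
      proof cases
        case 1
        then show ?thesis using A(2) contract_edge \<open>x \<noteq> v\<close> \<open>w \<noteq> v\<close> by (simp add: \<phi>_def)
      next
        case 2
        then have "card (A v \<inter> A w) = K4_mass (\<phi> v) (\<phi> w)" using A(2) contract_edge by simp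
        then show ?thesis using 2 AA \<open>w \<noteq> v\<close> by (simp add: \<phi>_def)
      next
        case 3
        then have "card (A x \<inter> A v) = K4_mass (\<phi> x) (\<phi> v)" using A(2) contract_edge by simp
        then show ?thesis using 3 AA \<open>x \<noteq> v\<close> by (simp add: \<phi>_def)
      qed
    qed
    moreover have "\<forall>w\<in>verts G'. A w \<subseteq> {..<4} \<and> card (A w) = K4_mass (\<phi>' w) (\<phi>' w)"
      using A(1) contract_edge by (auto simp: \<phi>_def)
    ultimately show False using assms(3) unfolding obstructed_def by blast
  qed
  then show ?thesis by blast
qed

lemma K4_minor_obstructed:
  assumes "has_minor G K4" "is_graph G"
  shows "\<exists>\<phi>. obstructed G \<phi>"
proof -
  obtain G' where G': "minor_step\<^sup>*\<^sup>* G G'" "graph_iso G' K4" using assms(1) unfolding has_minor_def by blast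
  from G'(1) assms(2) show ?thesis
  proof (induction rule: converse_rtranclp_induct)
    case base
    then show ?case using obstructed_K4 G'(2) by blast
  next
    case (step G H)
    then show ?case using minor_step_is_graph minor_step_obstructed by blast
  qed
qed

lemma sum_Pow_insert:
  assumes "finite A" "a \<notin> A"
  shows "sum f (Pow (insert a A)) = (\<Sum>S\<in>Pow A. f S + f (insert a S))"
proof -
  have "inj_on (insert a) (Pow A)" using assms(2) by (intro inj_onI) (metis Pow_iff in_mono insert_ident)
  moreover have "Pow A \<inter> insert a ` Pow A = {}" using assms(2) by blast
  ultimately show ?thesis using assms(1)
    by (simp add: Pow_insert sum.union_disjoint sum.reindex sum.distrib)
qed

lemma range_1_4: "{1..4::nat} = {1, 2, 3, 4}" by auto

text \<open>An integral signed weight with the same total and the same pair masses as the constant weight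
  \<open>1/4\<close> on the sixteen subsets of \<open>{1..4}\<close>. It puts weight 1 on each pair and makes up for this on the
  singletons and the empty set.\<close>
definition K4_weight :: "nat set \<Rightarrow> real" where
  "K4_weight T = (if card T = 2 then 1 else if card T = 1 then -1 else if T = {} then 2 else 0)"

lemma sum_Pow_1_4:
  "sum f (Pow {1..4::nat}) = f {} + f {1} + f {2} + f {3} + f {4} + f {1, 2} + f {1, 3} + f {1, 4} + f {2, 3}
    + f {2, 4} + f {3, 4} + f {1, 2, 3} + f {1, 2, 4} + f {1, 3, 4} + f {2, 3, 4} + f {1, 2, 3, 4 :: nat}"
  for f :: "nat set \<Rightarrow> real"
  unfolding range_1_4 by (simp add: sum_Pow_insert sum.distrib)

lemma K4_mass_cases:
  obtains "i = 1" | "i = 2" | "i = 3" | "i = 4" | "i \<notin> {1, 2, 3, 4::nat}"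
  by blast

lemma uniform_K4_mass:
  "pair_mass (Pow {1..4}) (\<lambda>_. 1/4) i j = real (K4_mass i j)"
  unfolding pair_mass_def sum_Pow_1_4 by (cases i rule: K4_mass_cases; cases j rule: K4_mass_cases) (simp_all add: K4_mass_def range_1_4)

lemma integer_K4_mass:
  "pair_mass (Pow {1..4}) K4_weight i j = real (K4_mass i j)"
  unfolding pair_mass_def sum_Pow_1_4 by (cases i rule: K4_mass_cases; cases j rule: K4_mass_cases)
   (simp_all add: K4_mass_def range_1_4 K4_weight_def)

lemma K4_weight_total: "sum K4_weight (Pow {1..4}) = 4"
  unfolding sum_Pow_1_4 by (simp add: K4_weight_def)

lemma uniform_total: "(\<Sum>T\<in>Pow {1..4::nat}. 1/4) = (4 :: real)"
  unfolding sum_Pow_1_4 by simp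

section \<open>Normality\<close>

lemma real_card_filter: "real (card {k. k < (t :: nat) \<and> Q k}) = (\<Sum>k<t. of_bool (Q k))"
proof -
  have "{k. k < t \<and> Q k} = {..<t} \<inter> {k. Q k}" by auto
  then show ?thesis by simp
qed

text \<open>The members of \<open>P\<close>, repeated according to their coefficients, are the columns of an incidence
  matrix, and the sets \<open>A v\<close> are its rows.\<close>
lemma sets_from_nat_coefficients:
  fixes c :: "'a set \<Rightarrow> real"
  assumes "finite P" and "\<And>S. S \<in> P \<Longrightarrow> c S \<in> \<nat>" and "sum c P = real t"
  obtains A :: "'a \<Rightarrow> nat set" where "\<And>v. A v \<subseteq> {..<t}" "\<And>u v. real (card (A u \<inter> A v)) = pair_mass P c u v"
proof -
  obtain t' g where t': "sum c P = real t'"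
    and g: "\<And>f :: 'a set \<Rightarrow> real. (\<Sum>S\<in>P. c S * f S) = (\<Sum>k<t'. f (g k))"
    by (rule nat_coefficients_as_sequence[where P = P and c = c, OF assms(1,2)])
      (assumption | rule that)+
  have "t' = t" using t' assms(3) by simp
  define A where "A v = {k. k < t \<and> v \<in> g k}" for v
  have "A u \<inter> A v = {k. k < t \<and> u \<in> g k \<and> v \<in> g k}" for u v unfolding A_def by blast
  then have "real (card (A u \<inter> A v)) = pair_mass P c u v" for u v
    unfolding pair_mass_def g \<open>t' = t\<close> by (simp only: real_card_filter)
  moreover have "A v \<subseteq> {..<t}" for v unfolding A_def by blast
  ultimately show thesis using that by blast
qed

text \<open>Conversely the coefficient of \<open>S\<close> counts the columns equal to \<open>S\<close>.\<close>
lemma nat_coefficients_from_sets: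
  fixes A :: "'a \<Rightarrow> nat set"
  assumes V: "finite V" and A: "\<And>v. v \<in> V \<Longrightarrow> A v \<subseteq> {..<t}"
  obtains c :: "'a set \<Rightarrow> real" where "\<And>S. c S \<in> \<nat>" "sum c (Pow V) = real t"
    "\<And>u v. u \<in> V \<Longrightarrow> v \<in> V \<Longrightarrow> pair_mass (Pow V) c u v = real (card (A u \<inter> A v))"
proof -
  define g where "g k = {v \<in> V. k \<in> A v}" for k
  define c where "c S = (\<Sum>k | k \<in> {..<t} \<and> g k = S. 1 :: real)" for S
  have g: "g ` {..<t} \<subseteq> Pow V" unfolding g_def by blast
  have c: "(\<Sum>S\<in>Pow V. c S * f S) = (\<Sum>k<t. f (g k))" for f
    using sum_over_fibres[OF finite_lessThan _ g, of "\<lambda>_. 1" f] V unfolding c_def by simp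
  show thesis
  proof (rule that[of c])
    show "c S \<in> \<nat>" for S unfolding c_def by simp
    show "sum c (Pow V) = real t" using c[of "\<lambda>_. 1"] by simp
    fix u v assume uv: "u \<in> V" "v \<in> V"
    have "A u \<inter> A v = {k. k < t \<and> u \<in> g k \<and> v \<in> g k}" using A uv unfolding g_def by blast
    then show "pair_mass (Pow V) c u v = real (card (A u \<inter> A v))"
      unfolding pair_mass_def c by (simp only: real_card_filter)
  qed
qed

text \<open>The nonnegative coefficients give a fractional family of events, the integer coefficients show
  that its masses are integers, and a realisation by sets gives coefficients in \<open>\<nat>\<close>.\<close>
lemma partial_2tree_imp_normal:
  assumes G: "is_graph ({1..n}, E)" and T: "partial_2tree {1..n} E"
  shows "cut_polytope_normal (suspension n E)"
  unfolding cut_polytope_normal_def lin_combs_suspension[OF G]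
proof (intro equalityI subsetI)
  fix z assume "z \<in> {cut_comb n E c | c. \<forall>S\<in>Pow {1..n}. c S \<in> \<nat>}"
  then obtain c where c: "z = cut_comb n E c" "\<And>S. S \<in> Pow {1..n} \<Longrightarrow> c S \<in> \<nat>" by blast
  have "c S \<in> \<int>" "c S \<in> {q \<in> \<rat>. 0 \<le> q}" if "S \<in> Pow {1..n}" for S
    using c(2)[OF that] by (auto elim!: Nats_cases)
  then show "z \<in> {cut_comb n E c | c. \<forall>S\<in>Pow {1..n}. c S \<in> \<int>} \<inter>
      {cut_comb n E c | c. \<forall>S\<in>Pow {1..n}. c S \<in> {q \<in> \<rat>. 0 \<le> q}}"
    using c(1) by blast
next
  fix z assume "z \<in> {cut_comb n E c | c. \<forall>S\<in>Pow {1..n}. c S \<in> \<int>} \<inter>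
      {cut_comb n E c | c. \<forall>S\<in>Pow {1..n}. c S \<in> {q \<in> \<rat>. 0 \<le> q}}"
  then obtain d c where d: "z = cut_comb n E d" "\<And>S. S \<in> Pow {1..n} \<Longrightarrow> d S \<in> \<int>"
    and c: "z = cut_comb n E c" "\<And>S. S \<in> Pow {1..n} \<Longrightarrow> 0 \<le> c S"
    by blast
  let ?P = "Pow {1..n}"
  have "cut_comb n E c = cut_comb n E d" using c d by simp
  then have eq: "sum c ?P = sum d ?P" "\<And>i. i \<in> {1..n} \<Longrightarrow> pair_mass ?P c i i = pair_mass ?P d i i"
    "\<And>i j. {i, j} \<in> E \<Longrightarrow> pair_mass ?P c i j = pair_mass ?P d i j"
    unfolding cut_comb_eq_iff[OF G] by blast+
  have int: "pair_mass ?P d i j \<in> \<int>" for i j unfolding pair_mass_def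
    by (intro Ints_sum Ints_mult d(2)) simp_all
  have "sum c ?P \<in> \<int>" unfolding eq(1) using d(2) by (rule Ints_sum)
  moreover have "0 \<le> sum c ?P" using c(2) by (rule sum_nonneg)
  ultimately have "sum c ?P \<in> \<nat>" by (simp add: Nats_altdef2)
  then obtain t where t: "sum c ?P = real t" by (rule Nats_cases)
  have "pair_mass ?P c v v \<in> \<int>" if "v \<in> {1..n}" for v using eq(2)[OF that] int by simp
  moreover have "pair_mass ?P c u v \<in> \<int>" if "{u, v} \<in> E" for u v using eq(3)[OF that] int by simp
  ultimately obtain A where A: "\<And>v. v \<in> {1..n} \<Longrightarrow> A v \<subseteq> {..<t}"
    "\<And>v. v \<in> {1..n} \<Longrightarrow> card (A v) = pair_mass ?P c v v"
    "\<And>u v. {u, v} \<in> E \<Longrightarrow> card (A u \<inter> A v) = pair_mass ?P c u v"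
    using integral_realisation[OF c(2) t T] by blast
  obtain e :: "nat set \<Rightarrow> real" where e: "\<And>S. e S \<in> \<nat>" "sum e ?P = real t"
    "\<And>u v. u \<in> {1..n} \<Longrightarrow> v \<in> {1..n} \<Longrightarrow> pair_mass ?P e u v = card (A u \<inter> A v)"
    by (rule nat_coefficients_from_sets[where V = "{1..n}" and A = A and t = t, OF finite_atLeastAtMost A(1)])
      (assumption | rule that)+
  have "pair_mass ?P e v v = pair_mass ?P c v v" if "v \<in> {1..n}" for v
    using e(3)[OF that that] A(2)[OF that] by simp
  moreover have "pair_mass ?P e u v = pair_mass ?P c u v" if "{u, v} \<in> E" for u v
    using e(3)[OF graph_edgeD(2,3)[OF G that]] A(3)[OF that] by simp
  ultimately have "cut_comb n E e = cut_comb n E c"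
    unfolding cut_comb_eq_iff[OF G] using e(2) t by simp
  then show "z \<in> {cut_comb n E c | c. \<forall>S\<in>?P. c S \<in> \<nat>}"
    using c(1) e(1) by (intro CollectI exI[of _ e]) simp
qed

text \<open>Weights on sets of labels are moved to sets of vertices by taking preimages under \<open>\<phi>\<close>. Distinct
  label sets can have the same preimage, so their weights are added.\<close>
lemma pair_mass_pullback:
  fixes w :: "'b set \<Rightarrow> real" and \<phi> :: "'a \<Rightarrow> 'b"
  assumes V: "finite V" and Q: "finite Q"
  defines "c \<equiv> \<lambda>S. \<Sum>T | T \<in> Q \<and> {v \<in> V. \<phi> v \<in> T} = S. w T"
  shows "sum c (Pow V) = sum w Q"
    and "u \<in> V \<Longrightarrow> v \<in> V \<Longrightarrow> pair_mass (Pow V) c u v = pair_mass Q w (\<phi> u) (\<phi> v)"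
proof -
  have "(\<lambda>T. {v \<in> V. \<phi> v \<in> T}) ` Q \<subseteq> Pow V" by blast
  note fibres = sum_over_fibres[OF Q _ this, of w]
  show "sum c (Pow V) = sum w Q" using fibres[of "\<lambda>_. 1"] V unfolding c_def by simp
  show "pair_mass (Pow V) c u v = pair_mass Q w (\<phi> u) (\<phi> v)" if "u \<in> V" "v \<in> V"
    using fibres[of "\<lambda>S. of_bool (u \<in> S \<and> v \<in> S)"] V that unfolding c_def pair_mass_def by simp
qed

text \<open>The constant weight \<open>1/4\<close> and the integral weight of the same masses, pulled back along \<open>\<phi>\<close>, give
  the same vector, which therefore lies in the lattice and in the cone. Coefficients in \<open>\<nat>\<close> for it
  would yield the sets that the obstruction excludes.\<close>
lemma obstructed_imp_not_normal:
  assumes G: "is_graph ({1..n}, E)" and \<phi>: "obstructed ({1..n}, E) \<phi>"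
  shows "\<not> cut_polytope_normal (suspension n E)"
proof
  assume normal: "cut_polytope_normal (suspension n E)"
  let ?P = "Pow {1..n}" and ?Q = "Pow {1..4::nat}"
  define pull where "pull w S = (\<Sum>T | T \<in> ?Q \<and> {v \<in> {1..n}. \<phi> v \<in> T} = S. w T)"
    for w :: "nat set \<Rightarrow> real" and S
  have fin: "finite {1..n}" "finite ?Q" by simp_all
  note pull = pair_mass_pullback[OF fin, where \<phi> = \<phi>, folded pull_def]
  define c where "c = pull (\<lambda>_. 1/4)"
  define d where "d = pull K4_weight"
  have c: "sum c ?P = 4" "\<And>u v. u \<in> {1..n} \<Longrightarrow> v \<in> {1..n} \<Longrightarrow> pair_mass ?P c u v = K4_mass (\<phi> u) (\<phi> v)"
    unfolding c_def by (simp_all only: pull uniform_total uniform_K4_mass)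
  have d: "sum d ?P = 4" "\<And>u v. u \<in> {1..n} \<Longrightarrow> v \<in> {1..n} \<Longrightarrow> pair_mass ?P d u v = K4_mass (\<phi> u) (\<phi> v)"
    unfolding d_def by (simp_all only: pull K4_weight_total integer_K4_mass)
  have "cut_comb n E c = cut_comb n E d"
    unfolding cut_comb_eq_iff[OF G] using c d graph_edgeD(2,3)[OF G] by simp
  moreover have "d S \<in> \<int>" for S unfolding d_def pull_def
    by (intro Ints_sum) (simp add: K4_weight_def)
  moreover have "c S \<in> {q \<in> \<rat>. 0 \<le> q}" for S
    unfolding c_def pull_def by (simp add: Rats_divide)
  ultimately have "cut_comb n E c \<in> {cut_comb n E c | c. \<forall>S\<in>?P. c S \<in> \<nat>}"
    using normal unfolding cut_polytope_normal_def lin_combs_suspension[OF G] by blast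
  then obtain e where e: "cut_comb n E e = cut_comb n E c" "\<And>S. S \<in> ?P \<Longrightarrow> e S \<in> \<nat>"
    by (elim CollectE exE conjE) (metis (no_types))
  have "sum e ?P = real 4" using e(1) c(1) unfolding cut_comb_eq_iff[OF G] by simp
  then obtain A :: "nat \<Rightarrow> nat set" where A: "\<And>v. A v \<subseteq> {..<4}"
    "\<And>u v. real (card (A u \<inter> A v)) = pair_mass ?P e u v"
    using sets_from_nat_coefficients[of ?P e 4] e(2) by auto
  have "real (card (A v)) = K4_mass (\<phi> v) (\<phi> v)" if "v \<in> {1..n}" for v
    using A(2)[of v v] e(1) c(2) that unfolding cut_comb_eq_iff[OF G] by simp
  moreover have "real (card (A u \<inter> A v)) = K4_mass (\<phi> u) (\<phi> v)" if "{u, v} \<in> E" for u v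
    using A(2)[of u v] e(1) c(2) that graph_edgeD(2,3)[OF G that] unfolding cut_comb_eq_iff[OF G] by simp
  ultimately show False using \<phi> A(1) unfolding obstructed_def fst_conv snd_conv of_nat_eq_iff by blast
qed

theorem theorem3p3:
  fixes n :: nat and E :: "nat set set"
  assumes "is_graph ({1..n}, E)"
  shows "cut_polytope_normal (suspension n E) \<longleftrightarrow>
    \<not> has_minor ({1..n}, E) (complete_graph {1..4::nat})"
  using K4_minor_free_partial_2tree[OF assms] partial_2tree_imp_normal[OF assms]
    K4_minor_obstructed[OF _ assms] obstructed_imp_not_normal[OF assms] by blast

end
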